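(* Let $G$ be a finite group, $m\ge 0$, and let $[\gamma]\in H^2(G\times C_2^m,\mathbb{Z}^* )$ be inflated from a cohomology class $[\delta]\in H^2(G,\mathbb{Z}^* )$ along the projection $G\times C_2^m\to G$. Then: (a) if $G$ has a normal complement in $\mathcal{U}(\mathbb{Z}^\delta[G])$, then $G\times C_2^m$ has a normal complement in $\mathcal{U}(\mathbb{Z}^\gamma[G\times C_2^m])$; (b) if $G$ has a torsion-free normal complement in $\mathcal{U}(\mathbb{Z}^\delta[G])$, then $G\times C_2^m$ has a torsion-free normal complement in $\mathcal{U}(\mathbb{Z}^\gamma[G\times C_2^m])$; (c) if $G$ satisfies the Higman subgroup property, then so does $G\times C_2^m$.
   Context: $\mathbb{Z}^*=\{\pm1\}$ with trivial action; cocycles are normalized. For a $2$-cocycle $\delta\in Z^2(H,\mathbb{Z}^* )$, $\mathbb{Z}^\delta[H]$ is the free $\mathbb{Z}$-module with basis $\{u_x\}_{x\in H}$ and multiplication $u_xu_y=\delta(x,y)u_{xy}$; $\mathcal{U}(\cdot)$ is the unit group and $\pm H=\{\pm u_x\mid x\in H\}$ is the group of trivial units. $H$ has a normal complement in $\mathcal{U}(\mathbb{Z}^\delta[H])$ if $\mathcal{U}(\mathbb{Z}^\delta[H])=M\rtimes(\pm H)$ for some normal subgroup $M$; it has a torsion-free normal complement if such an $M$ can be chosen torsion-free. A finite group $H$ satisfies the Higman subgroup property if every finite subgroup of $V(\mathbb{Z}H)$ (units of augmentation one of the ordinary integral group ring) is isomorphic to a subgroup of $H$. *)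

theory Defs
  imports "HOL-Algebra.Algebra"
begin

section \<open>Normalized \<open>2\<close>-cocycles with values in \<open>\<int>\<^sup>* = {\<plusminus>1}\<close> (trivial action)\<close>

text \<open>Cocycles and cochains are extensional functions, so that equality of cocycles is
  equality of functions. Since the coefficient group is \<open>{1, -1}\<close>, every value is its own inverse.\<close>

definition cocycles2 :: "('a, 'b) monoid_scheme \<Rightarrow> ('a \<times> 'a \<Rightarrow> int) monoid" where
  "cocycles2 H =
    \<lparr>carrier = {\<delta> \<in> carrier H \<times> carrier H \<rightarrow>\<^sub>E {1, -1}.
        (\<forall>x\<in>carrier H. \<forall>y\<in>carrier H. \<forall>z\<in>carrier H.
           \<delta> (x, y) * \<delta> (x \<otimes>\<^bsub>H\<^esub> y, z) = \<delta> (y, z) * \<delta> (x, y \<otimes>\<^bsub>H\<^esub> z)) \<and>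
        (\<forall>x\<in>carrier H. \<delta> (\<one>\<^bsub>H\<^esub>, x) = 1 \<and> \<delta> (x, \<one>\<^bsub>H\<^esub>) = 1)},
     monoid.mult = (\<lambda>\<alpha> \<beta>. \<lambda>p\<in>carrier H \<times> carrier H. \<alpha> p * \<beta> p),
     one = (\<lambda>p\<in>carrier H \<times> carrier H. 1)\<rparr>"

definition coboundary2 :: "('a, 'b) monoid_scheme \<Rightarrow> ('a \<Rightarrow> int) \<Rightarrow> 'a \<times> 'a \<Rightarrow> int" where
  "coboundary2 H c = (\<lambda>(x, y)\<in>carrier H \<times> carrier H. c x * c y * c (x \<otimes>\<^bsub>H\<^esub> y))"

text \<open>A coboundary of \<open>c\<close> is normalized exactly when \<open>c \<one> = 1\<close>.\<close>

definition coboundaries2 :: "('a, 'b) monoid_scheme \<Rightarrow> ('a \<times> 'a \<Rightarrow> int) set" where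
  "coboundaries2 H = coboundary2 H ` {c \<in> carrier H \<rightarrow>\<^sub>E {1, -1}. c \<one>\<^bsub>H\<^esub> = 1}"

text \<open>The class \<open>[\<delta>]\<close> as an element of \<open>H\<^sup>2(H, \<int>\<^sup>*) = cocycles2 H Mod coboundaries2 H\<close>.\<close>

definition cohomology_class ::
  "('a, 'b) monoid_scheme \<Rightarrow> ('a \<times> 'a \<Rightarrow> int) \<Rightarrow> ('a \<times> 'a \<Rightarrow> int) set" where
  "cohomology_class H \<delta> = coboundaries2 H #>\<^bsub>cocycles2 H\<^esub> \<delta>"

definition inflation ::
  "('c, 'd) monoid_scheme \<Rightarrow> ('c \<Rightarrow> 'a) \<Rightarrow> ('a \<times> 'a \<Rightarrow> int) \<Rightarrow> 'c \<times> 'c \<Rightarrow> int" where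
  "inflation K \<phi> \<delta> = (\<lambda>(x, y)\<in>carrier K \<times> carrier K. \<delta> (\<phi> x, \<phi> y))"


section \<open>Twisted group rings over the integers\<close>

text \<open>The underlying additive group is the free Abelian group on \<open>carrier H\<close>, with
  \<open>u\<^sub>x = frag_of x\<close>. The product is the biadditive extension of
  \<open>u\<^sub>x u\<^sub>y = \<delta>(x, y) u\<^sub>x\<^sub>y\<close>; \<open>u\<^sub>\<one>\<close> is its identity because \<open>\<delta>\<close> is normalized.\<close>

definition twisted_group_ring ::
  "('a, 'b) monoid_scheme \<Rightarrow> ('a \<times> 'a \<Rightarrow> int) \<Rightarrow> ('a \<Rightarrow>\<^sub>0 int) ring" where
  "twisted_group_ring H \<delta> =
    \<lparr>carrier = carrier (free_Abelian_group (carrier H)),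
     monoid.mult = (\<lambda>f g. frag_extend (\<lambda>x. frag_extend (\<lambda>y.
        frag_cmul (\<delta> (x, y)) (frag_of (x \<otimes>\<^bsub>H\<^esub> y))) g) f),
     one = frag_of \<one>\<^bsub>H\<^esub>,
     ring.zero = 0,
     ring.add = (+)\<rparr>"

lemma twisted_group_ring_mult_basis:
  "frag_of x \<otimes>\<^bsub>twisted_group_ring H \<delta>\<^esub> frag_of y = frag_cmul (\<delta> (x, y)) (frag_of (x \<otimes>\<^bsub>H\<^esub> y))"
  by (simp add: twisted_group_ring_def)

definition twisted_units ::
  "('a, 'b) monoid_scheme \<Rightarrow> ('a \<times> 'a \<Rightarrow> int) \<Rightarrow> ('a \<Rightarrow>\<^sub>0 int) monoid" where
  "twisted_units H \<delta> = units_of (twisted_group_ring H \<delta>)"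

definition trivial_units :: "('a, 'b) monoid_scheme \<Rightarrow> ('a \<Rightarrow>\<^sub>0 int) set" where
  "trivial_units H = {frag_of x | x. x \<in> carrier H} \<union> {- frag_of x | x. x \<in> carrier H}"


section \<open>Normal complements\<close>

definition internal_semidirect_product ::
  "('a, 'b) monoid_scheme \<Rightarrow> 'a set \<Rightarrow> 'a set \<Rightarrow> bool" where
  "internal_semidirect_product U M S \<longleftrightarrow>
     M \<lhd> U \<and> subgroup S U \<and> M \<inter> S = {\<one>\<^bsub>U\<^esub>} \<and> M <#>\<^bsub>U\<^esub> S = carrier U"

definition torsion_free :: "('a, 'b) monoid_scheme \<Rightarrow> bool" where
  "torsion_free M \<longleftrightarrow>
     (\<forall>x\<in>carrier M. \<forall>n::nat. 0 < n \<longrightarrow> x [^]\<^bsub>M\<^esub> n = \<one>\<^bsub>M\<^esub> \<longrightarrow> x = \<one>\<^bsub>M\<^esub>)"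

definition has_normal_complement ::
  "('a, 'b) monoid_scheme \<Rightarrow> ('a \<times> 'a \<Rightarrow> int) \<Rightarrow> bool" where
  "has_normal_complement H \<delta> \<longleftrightarrow>
     (\<exists>M. internal_semidirect_product (twisted_units H \<delta>) M (trivial_units H))"

definition has_torsion_free_normal_complement ::
  "('a, 'b) monoid_scheme \<Rightarrow> ('a \<times> 'a \<Rightarrow> int) \<Rightarrow> bool" where
  "has_torsion_free_normal_complement H \<delta> \<longleftrightarrow>
     (\<exists>M. internal_semidirect_product (twisted_units H \<delta>) M (trivial_units H) \<and>
          torsion_free ((twisted_units H \<delta>)\<lparr>carrier := M\<rparr>))"


section \<open>The Higman subgroup property\<close>

definition group_ring :: "('a, 'b) monoid_scheme \<Rightarrow> ('a \<Rightarrow>\<^sub>0 int) ring" where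
  "group_ring H = twisted_group_ring H \<one>\<^bsub>cocycles2 H\<^esub>"

definition augmentation :: "('a \<Rightarrow>\<^sub>0 int) \<Rightarrow> int" where
  "augmentation f = (\<Sum>x\<in>Poly_Mapping.keys f. Poly_Mapping.lookup f x)"

definition normalized_units :: "('a, 'b) monoid_scheme \<Rightarrow> ('a \<Rightarrow>\<^sub>0 int) monoid" where
  "normalized_units H =
     (units_of (group_ring H))\<lparr>carrier := {f \<in> Units (group_ring H). augmentation f = 1}\<rparr>"

definition Higman_subgroup_property :: "('a, 'b) monoid_scheme \<Rightarrow> bool" where
  "Higman_subgroup_property H \<longleftrightarrow>
     (\<forall>K. subgroup K (normalized_units H) \<and> finite K \<longrightarrow>
        (\<exists>L. subgroup L H \<and> (normalized_units H)\<lparr>carrier := K\<rparr> \<cong> H\<lparr>carrier := L\<rparr>))"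


section \<open>Elementary Abelian \<open>2\<close>-groups\<close>

definition C2_power :: "nat \<Rightarrow> (nat \<Rightarrow> int) monoid" where
  "C2_power m = product_group {..<m} (\<lambda>_. integer_mod_group 2)"

end

theory Submission
  imports Defs "Jordan_Normal_Form.Schur_Decomposition"
begin

text \<open>Write \<open>E = C\<^sub>2\<^sup>m\<close> and let \<open>\<gamma>\<close> differ from the inflation of \<open>\<delta>\<close> by the coboundary of \<open>c\<close>. On units of the
  twisted group ring of \<open>G \<times> E\<close> there are two homomorphisms: \<open>proj\<close>, induced by
  \<open>u\<^sub>x \<mapsto> c(x) u\<^bsub>fst x\<^esub>\<close>, into the units over \<open>G\<close>, and \<open>parity\<close>, sending \<open>f\<close> to
  \<open>\<Sum> f\<^sub>x (snd x)\<close> in the \<open>\<int>/2\<close>-vector space \<open>E\<close>. The latter is multiplicative because modulo 2 it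
  is a derivation over the augmentation, and units have odd augmentation. Together they map the
  trivial units bijectively onto \<open>(\<plusminus>G) \<times> E\<close>, so a normal complement \<open>M\<close> over \<open>G\<close> pulls back to
  the normal complement of all \<open>f\<close> with \<open>proj f \<in> M\<close> and \<open>parity f = 1\<close>.

  The joint kernel is torsion-free: if \<open>proj f = 1\<close>, some coefficient of \<open>f\<close> at a central involution
  (or identity) \<open>(1, e)\<close> is nonzero, so the Berman--Higman theorem applied to \<open>f u\<^bsub>(1,e)\<^esub>\<close> shows that a
  torsion unit \<open>f\<close> is trivial. This gives (b), and for (c) it makes
  \<open>(proj, parity)\<close> injective on finite subgroups.\<close>

section \<open>Complex matrices of finite order\<close>

lemma index_mult_mat_sum:
  assumes "A \<in> carrier_mat n n" "B \<in> carrier_mat n n" "i < n" "j < n"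
  shows "(A * B) $$ (i, j) = (\<Sum>l<n. A $$ (i, l) * B $$ (l, j))"
  using assms by (auto simp: scalar_prod_def atLeast0LessThan intro!: sum.cong)

text \<open>Cyclicity of the trace; it gives invariance of the trace under similarity, where
  \<open>P\<close>, \<open>B\<close>, \<open>Q\<close> satisfy \<open>P * B * Q = A\<close> and
  \<open>Q * P = 1\<close>.\<close>

lemma sum_diag_mult_commute:
  fixes A B :: "'a::comm_semiring_0 mat"
  assumes "A \<in> carrier_mat n n" "B \<in> carrier_mat n n"
  shows "(\<Sum>i<n. (A * B) $$ (i, i)) = (\<Sum>i<n. (B * A) $$ (i, i))"
proof -
  have "(\<Sum>i<n. (A * B) $$ (i, i)) = (\<Sum>i<n. \<Sum>l<n. A $$ (i, l) * B $$ (l, i))"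
    using assms by (intro sum.cong) (auto simp: index_mult_mat_sum simp del: index_mult_mat)
  also have "\<dots> = (\<Sum>l<n. \<Sum>i<n. B $$ (l, i) * A $$ (i, l))"
    by (subst sum.swap) (simp add: mult.commute)
  also have "\<dots> = (\<Sum>i<n. (B * A) $$ (i, i))"
    using assms by (intro sum.cong) (auto simp: index_mult_mat_sum simp del: index_mult_mat)
  finally show ?thesis .
qed

text \<open>In the sum for entry (i, j) of a product of upper triangular matrices, the term with
  index \<open>l\<close> survives only for i \<le> l \<le> j. Hence nothing is left below the
  diagonal and a single term on it.\<close>

lemma upper_triangular_pow_diag:
  fixes B :: "'a::comm_ring_1 mat"
  assumes B: "B \<in> carrier_mat n n" and ut: "upper_triangular B"
  shows "upper_triangular (B ^\<^sub>m p) \<and> (\<forall>i<n. (B ^\<^sub>m p) $$ (i, i) = B $$ (i, i) ^ p)"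
proof (induction p)
  case 0
  then show ?case using B by auto
next
  case (Suc p)
  have Bp: "B ^\<^sub>m p \<in> carrier_mat n n" using B by simp
  have lower: "(B ^\<^sub>m p) $$ (i, j) = 0" "B $$ (i, j) = 0" if "j < i" "i < n" for i j
    using Suc ut that B Bp by (auto dest: upper_triangularD)
  have low: "(B ^\<^sub>m Suc p) $$ (i, j) = 0" if "j < i" "i < n" for i j
  proof -
    have "(B ^\<^sub>m p) $$ (i, l) * B $$ (l, j) = 0" if "l < n" for l
      using lower[of l i] lower[of j l] \<open>j < i\<close> \<open>i < n\<close> that by (cases "l < i") auto
    then show ?thesis using that by (simp add: index_mult_mat_sum[OF Bp B] del: index_mult_mat)
  qed
  have "(B ^\<^sub>m Suc p) $$ (i, i) = B $$ (i, i) ^ Suc p" if "i < n" for i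
  proof -
    have "(B ^\<^sub>m p) $$ (i, l) * B $$ (l, i) = (if l = i then B $$ (i, i) ^ Suc p else 0)" if "l < n" for l
      using lower[of l i] lower[of i l] Suc \<open>i < n\<close> that
      by (cases l i rule: linorder_cases) (auto simp: mult.commute)
    then show ?thesis using that by (simp add: index_mult_mat_sum[OF Bp B] del: index_mult_mat)
  qed
  moreover have "upper_triangular (B ^\<^sub>m Suc p)"
    using low B Bp by (intro upper_triangularI) auto
  ultimately show ?case by blast
qed

text \<open>The superdiagonals vanish one after another. On the first one not yet known to be zero,
  an entry of the \<open>p\<close>-th power is p s^(p-1) times the entry of \<open>B\<close>, and
  for p = k it must be 0. Characteristic 0 then forces the entry of \<open>B\<close> to be
  0.\<close>

lemma upper_triangular_finite_order:
  fixes B :: "'a::field_char_0 mat"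
  assumes B: "B \<in> carrier_mat n n" and ut: "upper_triangular B"
    and diag: "\<And>i. i < n \<Longrightarrow> B $$ (i, i) = s" and "s \<noteq> 0"
    and pow: "B ^\<^sub>m k = 1\<^sub>m n" and "0 < k"
  shows "B = s \<cdot>\<^sub>m 1\<^sub>m n"
proof -
  have offdiag: "B $$ (i, i + Suc d) = 0" if "i + Suc d < n" for i d
    using that
  proof (induction d arbitrary: i rule: less_induct)
    case (less d)
    define j where "j = i + Suc d"
    have i: "i < j" "j < n" using less.prems by (auto simp: j_def)
    have zero: "B $$ (l, j) = 0" if "i < l" "l < j" for l
    proof -
      have "B $$ (l, l + Suc (j - Suc l)) = 0"
        using that less.prems by (intro less.IH) (auto simp: j_def)
      then show ?thesis using that by simp
    qed
    \<comment> \<open>The extra factor \<open>s\<close> avoids the exponent p - 1, which would be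
      truncated at p = 0.\<close>
    have "(B ^\<^sub>m p) $$ (i, j) * s = of_nat p * s ^ p * B $$ (i, j)" for p
    proof (induction p)
      case 0
      then show ?case using B i by simp
    next
      case (Suc p)
      have Bp: "B ^\<^sub>m p \<in> carrier_mat n n" using B by simp
      have ii: "(B ^\<^sub>m p) $$ (i, i) = s ^ p" and Put: "upper_triangular (B ^\<^sub>m p)"
        using upper_triangular_pow_diag[OF B ut, of p] diag i by auto
      have "(B ^\<^sub>m Suc p) $$ (i, j) = (\<Sum>l<n. (B ^\<^sub>m p) $$ (i, l) * B $$ (l, j))"
        using i by (simp add: index_mult_mat_sum[OF Bp B] del: index_mult_mat)
      \<comment> \<open>Indices below \<open>i\<close> drop out by triangularity of the power, those
        above \<open>j\<close> by triangularity of \<open>B\<close>, and those strictly between by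
        the induction hypothesis on the earlier superdiagonals.\<close>
      also have "\<dots> = (\<Sum>l\<in>{i, j}. (B ^\<^sub>m p) $$ (i, l) * B $$ (l, j))"
      proof (rule sum.mono_neutral_right)
        show "\<forall>l\<in>{..<n} - {i, j}. (B ^\<^sub>m p) $$ (i, l) * B $$ (l, j) = 0"
        proof
          fix l assume l: "l \<in> {..<n} - {i, j}"
          consider "l < i" | "i < l" "l < j" | "j < l" using l by fastforce
          then show "(B ^\<^sub>m p) $$ (i, l) * B $$ (l, j) = 0"
          proof cases
            case 1
            then show ?thesis using upper_triangularD[OF Put, of l i] i B by simp
          next
            case 2
            then show ?thesis using zero by simp
          next
            case 3
            then show ?thesis using upper_triangularD[OF ut, of j l] l B by simp
          qed
        qed
      qed (use i in auto)
      also have "\<dots> = s ^ p * B $$ (i, j) + (B ^\<^sub>m p) $$ (i, j) * s"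
        using i ii diag by simp
      finally have "(B ^\<^sub>m Suc p) $$ (i, j) = s ^ p * B $$ (i, j) + of_nat p * s ^ p * B $$ (i, j)"
        using Suc by simp
      then show ?case by (simp add: algebra_simps)
    qed
    from this[of k] have "of_nat k * s ^ k * B $$ (i, j) = 0"
      using pow i by simp
    then show ?case using \<open>s \<noteq> 0\<close> \<open>0 < k\<close> by (simp add: j_def)
  qed
  show ?thesis
  proof (rule eq_matI)
    fix i j assume "i < dim_row (s \<cdot>\<^sub>m 1\<^sub>m n)" "j < dim_col (s \<cdot>\<^sub>m 1\<^sub>m n)"
    then have ij: "i < n" "j < n" by auto
    show "B $$ (i, j) = (s \<cdot>\<^sub>m 1\<^sub>m n) $$ (i, j)"
    proof (cases i j rule: linorder_cases)
      case less
      then have "B $$ (i, i + Suc (j - Suc i)) = 0" using ij by (intro offdiag) simp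
      then show ?thesis using less ij by simp
    next
      case equal
      then show ?thesis using ij diag by simp
    next
      case greater
      then show ?thesis using upper_triangularD[OF ut, of j i] ij B by simp
    qed
  qed (use B in auto)
qed

text \<open>After triangularization the diagonal consists of \<open>n\<close> roots of unity whose sum is a nonzero
  integral multiple of \<open>n\<close>, so all of them equal the same sign.\<close>

lemma finite_order_mat_scalar:
  fixes A :: "complex mat" and t :: int
  assumes A: "A \<in> carrier_mat n n" and pow: "A ^\<^sub>m k = 1\<^sub>m n" and "0 < k"
    and trace: "(\<Sum>i<n. A $$ (i, i)) = of_nat n * of_int t" and "t \<noteq> 0"
  shows "A = of_int (sgn t) \<cdot>\<^sub>m 1\<^sub>m n"
proof -
  define s :: int where "s = sgn t"
  have s: "s * s = 1" "s * t \<ge> 1" using \<open>t \<noteq> 0\<close> by (auto simp: s_def sgn_if)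
  obtain es where "char_poly A = (\<Prod>a\<leftarrow>es. [:- a, 1:])"
    using char_poly_factorized[OF A] by blast
  from schur_decomposition_exists[OF A this] obtain B
    where B: "B \<in> carrier_mat n n" and ut: "upper_triangular B" and "similar_mat A B" by blast
  then obtain P Q where wit: "similar_mat_wit A B P Q" by (auto simp: similar_mat_def)
  note w = similar_mat_witD2[OF A wit]
  have powB: "B ^\<^sub>m k = 1\<^sub>m n"
    using similar_mat_witD(3)[OF _ similar_mat_wit_sym[OF similar_mat_wit_pow[OF wit, of k]]] pow w
    by simp
  have "(\<Sum>i<n. A $$ (i, i)) = (\<Sum>i<n. (P * (B * Q)) $$ (i, i))"
    using w by (simp add: assoc_mult_mat[of P n n B n Q n])
  also have "\<dots> = (\<Sum>i<n. (B * Q * P) $$ (i, i))"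
    using w by (intro sum_diag_mult_commute) auto
  also have "B * Q * P = B" using w by (simp add: assoc_mult_mat[of B n n Q n P n])
  finally have trB: "(\<Sum>i<n. B $$ (i, i)) = of_nat n * of_int t" using trace by simp
  have norm1: "norm (B $$ (i, i)) = 1" if "i < n" for i
  proof -
    have "B $$ (i, i) ^ k = 1"
      using upper_triangular_pow_diag[OF B ut, of k] powB that by (metis index_one_mat(1))
    then show ?thesis using \<open>0 < k\<close> power_eq_1_iff by blast
  qed
  \<comment> \<open>After rotation by the sign \<open>s\<close> the eigenvalues still have modulus
    1, and their sum is n |t| \<ge> n. Each real part is at most 1, so every real part equals 1 and
    hence every \<open>z i\<close> is 1.\<close>
  define z where "z i = of_int s * B $$ (i, i)" for i
  have nz: "norm (z i) = 1" if "i < n" for i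
    using norm1[OF that] s(1) by (auto simp: z_def norm_mult zmult_eq_1_iff)
  then have Re_le: "Re (z i) \<le> 1" if "i < n" for i
    using that complex_Re_le_cmod[of "z i"] by simp
  have "(\<Sum>i<n. z i) = of_nat n * of_int (s * t)"
    using trB by (simp add: z_def flip: sum_distrib_left)
  then have "(\<Sum>i<n. Re (z i)) = real n * of_int (s * t)"
    by (metis Re_sum Re_complex_of_real of_real_mult of_real_of_int_eq of_real_of_nat_eq)
  also have "\<dots> \<ge> real n" using s(2) by (simp add: mult_le_cancel_left1 flip: of_int_mult)
  finally have "(\<Sum>i<n. 1 - Re (z i)) \<le> 0" by (simp add: sum_subtractf)
  moreover have "(\<Sum>i<n. 1 - Re (z i)) \<ge> 0" using Re_le by (intro sum_nonneg) auto
  ultimately have "\<forall>i\<in>{..<n}. 1 - Re (z i) = 0"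
    using Re_le by (subst sum_nonneg_eq_0_iff[symmetric]) auto
  then have z1: "z i = 1" if "i < n" for i
    using nz[OF that] that by (auto simp: complex_eq_iff cmod_def)
  then have diag: "B $$ (i, i) = of_int s" if "i < n" for i
    using z1[OF that] s(1) by (auto simp: z_def zmult_eq_1_iff minus_equation_iff)
  have "B = of_int s \<cdot>\<^sub>m 1\<^sub>m n"
    using upper_triangular_finite_order[OF B ut diag _ powB \<open>0 < k\<close>] s by fastforce
  \<comment> \<open>A scalar matrix is unchanged by conjugation, so the form of \<open>B\<close>
    passes back to \<open>A\<close>.\<close>
  then have "A = of_int s \<cdot>\<^sub>m 1\<^sub>m n"
    using w by (simp add: mult_smult_assoc_mat[of _ n n _ n] mult_smult_distrib[of _ n n _ n])
  then show ?thesis by (simp add: s_def)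
qed

section \<open>Twisted group rings\<close>

lemma frag_cmul_diff_distrib2: "frag_cmul c (a - b) = frag_cmul c a - frag_cmul c b"
  by (rule poly_mapping_eqI) (simp add: lookup_minus right_diff_distrib)

lemma frag_extend_fun_diff:
  "frag_extend (\<lambda>x. h x - k x) f = frag_extend h f - frag_extend k f"
  by (simp add: frag_extend_def frag_cmul_diff_distrib2 sum_subtractf)

lemma frag_extend_fun_cmul: "frag_extend (\<lambda>x. frag_cmul c (h x)) f = frag_cmul c (frag_extend h f)"
  by (simp add: frag_extend_def frag_cmul_sum mult.commute)

text \<open>The integer-valued linear functional on the free abelian group with value
  \<open>w x\<close> at the basis element \<open>frag_of x\<close>. Both the augmentation and the
  coordinates underlying \<open>parity\<close> are of this form.\<close>

definition frag_sum :: "('a \<Rightarrow> int) \<Rightarrow> ('a \<Rightarrow>\<^sub>0 int) \<Rightarrow> int" where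
  "frag_sum w f = (\<Sum>x\<in>Poly_Mapping.keys f. Poly_Mapping.lookup f x * w x)"

lemma frag_sum_superset:
  assumes "finite A" "Poly_Mapping.keys f \<subseteq> A"
  shows "frag_sum w f = (\<Sum>x\<in>A. Poly_Mapping.lookup f x * w x)"
  unfolding frag_sum_def using assms by (intro sum.mono_neutral_left) (auto simp: in_keys_iff)

lemma frag_sum_0 [simp]: "frag_sum w 0 = 0"
  by (simp add: frag_sum_def)

lemma frag_sum_of [simp]: "frag_sum w (frag_of x) = w x"
  by (simp add: frag_sum_def)

lemma frag_sum_diff: "frag_sum w (f - g) = frag_sum w f - frag_sum w g"
proof -
  let ?A = "Poly_Mapping.keys f \<union> Poly_Mapping.keys g"
  show ?thesis
    using keys_diff[of f g]
    by (subst (1 2 3) frag_sum_superset[of ?A])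
       (auto simp: lookup_minus left_diff_distrib sum_subtractf)
qed

lemma frag_sum_uminus: "frag_sum w (- f) = - frag_sum w f"
  using frag_sum_diff[of w 0 f] by simp

lemma frag_sum_cmul: "frag_sum w (frag_cmul c f) = c * frag_sum w f"
  by (subst frag_sum_superset[of "Poly_Mapping.keys f"])
     (auto simp: frag_sum_def sum_distrib_left mult.assoc)

lemma frag_sum_fun_add: "frag_sum (\<lambda>x. v x + w x) f = frag_sum v f + frag_sum w f"
  by (simp add: frag_sum_def distrib_left sum.distrib)

lemma frag_sum_fun_cmul: "frag_sum (\<lambda>x. w x * c) f = frag_sum w f * c"
  by (simp add: frag_sum_def sum_distrib_right mult.assoc)

lemma frag_sum_const: "frag_sum (\<lambda>_. c) f = augmentation f * c"
  by (simp add: frag_sum_def augmentation_def sum_distrib_right)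

lemma augmentation_eq_frag_sum: "augmentation f = frag_sum (\<lambda>_. 1) f"
  by (simp add: frag_sum_const)

lemma frag_sum_cong:
  "(\<And>x. x \<in> Poly_Mapping.keys f \<Longrightarrow> v x = w x) \<Longrightarrow> frag_sum v f = frag_sum w f"
  by (simp add: frag_sum_def)

lemma frag_sum_parity_cong:
  assumes "\<And>x. x \<in> Poly_Mapping.keys f \<Longrightarrow> even (v x - w x)"
  shows "even (frag_sum v f - frag_sum w f)"
  unfolding frag_sum_def sum_subtractf[symmetric] right_diff_distrib[symmetric]
  using assms by (intro dvd_sum) auto

locale twisted_ring = group H for H :: "('a, 'b) monoid_scheme" (structure) +
  fixes \<delta> :: "'a \<times> 'a \<Rightarrow> int"
  assumes fin: "finite (carrier H)" and cocycle: "\<delta> \<in> carrier (cocycles2 H)"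
begin

abbreviation R where "R \<equiv> twisted_group_ring H \<delta>"

lemma cocycle_values: "x \<in> carrier H \<Longrightarrow> y \<in> carrier H \<Longrightarrow> \<delta> (x, y) \<in> {1, -1}"
  using cocycle by (auto simp: cocycles2_def)

lemma cocycle_square: "x \<in> carrier H \<Longrightarrow> y \<in> carrier H \<Longrightarrow> \<delta> (x, y) * \<delta> (x, y) = 1"
  using cocycle_values[of x y] by auto

lemma cocycle_identity:
  "x \<in> carrier H \<Longrightarrow> y \<in> carrier H \<Longrightarrow> z \<in> carrier H \<Longrightarrow>
    \<delta> (x, y) * \<delta> (x \<otimes> y, z) = \<delta> (y, z) * \<delta> (x, y \<otimes> z)"
  using cocycle by (auto simp: cocycles2_def)

lemma cocycle_one [simp]: "x \<in> carrier H \<Longrightarrow> \<delta> (\<one>, x) = 1" "x \<in> carrier H \<Longrightarrow> \<delta> (x, \<one>) = 1"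
  using cocycle by (auto simp: cocycles2_def)

section \<open>Monoid laws of the twisted group ring\<close>

lemma R_carrier [simp]: "f \<in> carrier R \<longleftrightarrow> Poly_Mapping.keys f \<subseteq> carrier H"
  by (simp add: twisted_group_ring_def free_Abelian_group_def)

lemma R_one [simp]: "\<one>\<^bsub>R\<^esub> = frag_of \<one>"
  by (simp add: twisted_group_ring_def)

lemma R_mult_0 [simp]: "f \<otimes>\<^bsub>R\<^esub> 0 = 0" "0 \<otimes>\<^bsub>R\<^esub> f = 0"
  by (simp_all add: twisted_group_ring_def frag_extend_eq_0)

text \<open>Additivity is phrased with differences because \<open>frag_induction\<close> builds
  elements from basis elements by subtraction.\<close>

lemma R_mult_diff_right: "f \<otimes>\<^bsub>R\<^esub> (g - h) = f \<otimes>\<^bsub>R\<^esub> g - f \<otimes>\<^bsub>R\<^esub> h"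
  by (simp add: twisted_group_ring_def frag_extend_diff frag_extend_fun_diff)

lemma R_mult_diff_left: "(f - g) \<otimes>\<^bsub>R\<^esub> h = f \<otimes>\<^bsub>R\<^esub> h - g \<otimes>\<^bsub>R\<^esub> h"
  by (simp add: twisted_group_ring_def frag_extend_diff)

lemma R_mult_cmul_left: "frag_cmul c f \<otimes>\<^bsub>R\<^esub> g = frag_cmul c (f \<otimes>\<^bsub>R\<^esub> g)"
  by (simp add: twisted_group_ring_def frag_extend_cmul)

lemma R_mult_cmul_right: "f \<otimes>\<^bsub>R\<^esub> frag_cmul c g = frag_cmul c (f \<otimes>\<^bsub>R\<^esub> g)"
  by (simp add: twisted_group_ring_def frag_extend_cmul frag_extend_fun_cmul)

lemma R_mult_basis: "frag_of x \<otimes>\<^bsub>R\<^esub> frag_of y = frag_cmul (\<delta> (x, y)) (frag_of (x \<otimes> y))"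
  by (rule twisted_group_ring_mult_basis)

lemma R_closed:
  assumes "f \<in> carrier R" "g \<in> carrier R"
  shows "f \<otimes>\<^bsub>R\<^esub> g \<in> carrier R"
proof -
  have g: "Poly_Mapping.keys (frag_of x \<otimes>\<^bsub>R\<^esub> g) \<subseteq> carrier H" if "x \<in> carrier H" for x
    using assms(2)[unfolded R_carrier]
  proof (induction g rule: frag_induction)
    case (diff a b)
    then show ?case using keys_diff by (fastforce simp: R_mult_diff_right)
  qed (use that in \<open>auto simp: R_mult_basis\<close>)
  have "Poly_Mapping.keys (f \<otimes>\<^bsub>R\<^esub> g) \<subseteq> carrier H"
    using assms(1)[unfolded R_carrier]
  proof (induction f rule: frag_induction)
    case (diff a b)
    then show ?case using keys_diff by (fastforce simp: R_mult_diff_left)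
  qed (use g in auto)
  then show ?thesis by simp
qed

text \<open>Additivity in each of the three arguments reduces the claim to basis elements, where the
  signs on the two sides agree precisely by the cocycle identity.\<close>

lemma R_assoc:
  assumes "f \<in> carrier R" "g \<in> carrier R" "h \<in> carrier R"
  shows "f \<otimes>\<^bsub>R\<^esub> g \<otimes>\<^bsub>R\<^esub> h = f \<otimes>\<^bsub>R\<^esub> (g \<otimes>\<^bsub>R\<^esub> h)"
proof -
  have basis: "frag_of x \<otimes>\<^bsub>R\<^esub> frag_of y \<otimes>\<^bsub>R\<^esub> frag_of z = frag_of x \<otimes>\<^bsub>R\<^esub> (frag_of y \<otimes>\<^bsub>R\<^esub> frag_of z)"
    if "x \<in> carrier H" "y \<in> carrier H" "z \<in> carrier H" for x y z
    using that cocycle_identity[OF that] 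
    by (simp add: R_mult_basis R_mult_cmul_left R_mult_cmul_right m_assoc)
  have z: "frag_of x \<otimes>\<^bsub>R\<^esub> frag_of y \<otimes>\<^bsub>R\<^esub> h = frag_of x \<otimes>\<^bsub>R\<^esub> (frag_of y \<otimes>\<^bsub>R\<^esub> h)"
    if "x \<in> carrier H" "y \<in> carrier H" for x y
    using assms(3)[unfolded R_carrier]
    by (induction h rule: frag_induction) (simp_all add: basis that R_mult_diff_right)
  have y: "frag_of x \<otimes>\<^bsub>R\<^esub> g \<otimes>\<^bsub>R\<^esub> h = frag_of x \<otimes>\<^bsub>R\<^esub> (g \<otimes>\<^bsub>R\<^esub> h)" if "x \<in> carrier H" for x
    using assms(2)[unfolded R_carrier]
    by (induction g rule: frag_induction) (simp_all add: z that R_mult_diff_right R_mult_diff_left)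
  show ?thesis
    using assms(1)[unfolded R_carrier]
    by (induction f rule: frag_induction) (simp_all add: y R_mult_diff_left)
qed

lemma R_l_one: "f \<in> carrier R \<Longrightarrow> frag_of \<one> \<otimes>\<^bsub>R\<^esub> f = f"
  unfolding R_carrier
  by (induction f rule: frag_induction) (simp_all add: R_mult_diff_right R_mult_basis)

lemma R_r_one: "f \<in> carrier R \<Longrightarrow> f \<otimes>\<^bsub>R\<^esub> frag_of \<one> = f"
  unfolding R_carrier
  by (induction f rule: frag_induction) (simp_all add: R_mult_diff_left R_mult_basis)

lemma R_monoid: "Group.monoid R"
  by (rule Group.monoidI) (use R_closed R_assoc R_l_one R_r_one in auto)

sublocale R: Group.monoid R
  by (rule R_monoid)

section \<open>The unit group and its trivial units\<close>

sublocale U: group "twisted_units H \<delta>"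
  unfolding twisted_units_def by (rule R.units_group)

lemma U_carrier: "carrier (twisted_units H \<delta>) = Units R"
  and U_mult: "a \<otimes>\<^bsub>twisted_units H \<delta>\<^esub> b = a \<otimes>\<^bsub>R\<^esub> b"
  and U_one: "\<one>\<^bsub>twisted_units H \<delta>\<^esub> = frag_of \<one>"
  by (simp_all add: twisted_units_def units_of_carrier units_of_mult units_of_one)

lemma U_pow: "a [^]\<^bsub>twisted_units H \<delta>\<^esub> (n::nat) = a [^]\<^bsub>R\<^esub> n"
  by (induction n) (simp_all add: U_mult U_one)

text \<open>Carrying the sign as a scalar allows a single product formula,
  \<open>trivial_unit_mult\<close>, in place of a case distinction on signs.\<close>

lemma trivial_units_eq: "trivial_units H = {frag_cmul s (frag_of x) | s x. s \<in> {1, -1} \<and> x \<in> carrier H}"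
proof (intro equalityI subsetI)
  fix a assume "a \<in> trivial_units H"
  then consider x where "a = frag_cmul 1 (frag_of x)" "x \<in> carrier H" | x where "a = frag_cmul (-1) (frag_of x)" "x \<in> carrier H"
    by (auto simp: trivial_units_def)
  then show "a \<in> {frag_cmul s (frag_of x) | s x. s \<in> {1, -1} \<and> x \<in> carrier H}"
    by cases blast+
qed (auto simp: trivial_units_def)

lemma trivial_unit_mult:
  "frag_cmul s (frag_of x) \<otimes>\<^bsub>R\<^esub> frag_cmul t (frag_of y) = frag_cmul (s * t * \<delta> (x, y)) (frag_of (x \<otimes> y))"
  by (simp add: R_mult_cmul_left R_mult_cmul_right R_mult_basis mult_ac)

lemma trivial_unit_inverse:
  assumes "s \<in> {1, -1}" "x \<in> carrier H"
  defines "b \<equiv> frag_cmul (s * \<delta> (x, inv x)) (frag_of (inv x))"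
  shows "b \<in> trivial_units H" "frag_cmul s (frag_of x) \<otimes>\<^bsub>R\<^esub> b = frag_of \<one>" "b \<otimes>\<^bsub>R\<^esub> frag_cmul s (frag_of x) = frag_of \<one>"
proof -
  have s: "s * s = 1" using assms by auto
  \<comment> \<open>The cocycle identity for x, x^-1, x together with normalization; it makes the
    right inverse also a left inverse.\<close>
  have "\<delta> (inv x, x) = \<delta> (x, inv x)"
    using cocycle_identity[of x "inv x" x] assms by simp
  then show "frag_cmul s (frag_of x) \<otimes>\<^bsub>R\<^esub> b = frag_of \<one>" "b \<otimes>\<^bsub>R\<^esub> frag_cmul s (frag_of x) = frag_of \<one>"
    using s cocycle_square[of x "inv x"] assms(2)
    by (simp_all add: b_def trivial_unit_mult mult_ac)
  have "s * \<delta> (x, inv x) \<in> {1, -1}"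
    using assms(1,2) cocycle_values[of x "inv x"] by auto
  then show "b \<in> trivial_units H"
    using assms unfolding trivial_units_eq by blast
qed

lemma trivial_units_subset: "trivial_units H \<subseteq> Units R"
proof
  fix a assume "a \<in> trivial_units H"
  then obtain s x where a: "a = frag_cmul s (frag_of x)" "s \<in> {1, -1}" "x \<in> carrier H"
    unfolding trivial_units_eq by blast
  let ?b = "frag_cmul (s * \<delta> (x, inv x)) (frag_of (inv x))"
  have "?b \<in> carrier R" "a \<in> carrier R" using a by auto
  then show "a \<in> Units R"
    using trivial_unit_inverse[OF a(2,3)] a unfolding Units_def by auto
qed

lemma trivial_units_subgroup: "subgroup (trivial_units H) (twisted_units H \<delta>)"
proof (rule U.subgroupI)
  show "trivial_units H \<subseteq> carrier (twisted_units H \<delta>)"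
    using trivial_units_subset by (simp add: U_carrier)
  show "trivial_units H \<noteq> {}" by (auto simp: trivial_units_def)
next
  fix a assume "a \<in> trivial_units H"
  then obtain s x where a: "a = frag_cmul s (frag_of x)" "s \<in> {1, -1}" "x \<in> carrier H"
    unfolding trivial_units_eq by blast
  note b = trivial_unit_inverse[OF a(2,3)]
  have "inv\<^bsub>twisted_units H \<delta>\<^esub> a = frag_cmul (s * \<delta> (x, inv x)) (frag_of (inv x))"
    using a b trivial_units_subset \<open>a \<in> trivial_units H\<close>
    by (intro U.inv_equality) (auto simp: U_carrier U_mult U_one)
  then show "inv\<^bsub>twisted_units H \<delta>\<^esub> a \<in> trivial_units H"
    using b by simp
next
  fix a b assume "a \<in> trivial_units H" "b \<in> trivial_units H"
  then obtain s x t y where a: "a = frag_cmul s (frag_of x)" "s \<in> {1, -1}" "x \<in> carrier H"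
    and b: "b = frag_cmul t (frag_of y)" "t \<in> {1, -1}" "y \<in> carrier H"
    unfolding trivial_units_eq by blast
  have "s * t * \<delta> (x, y) \<in> {1, -1}"
    using a b cocycle_values[of x y] by auto
  then show "a \<otimes>\<^bsub>twisted_units H \<delta>\<^esub> b \<in> trivial_units H"
    using a b unfolding U_mult trivial_units_eq by (auto simp: trivial_unit_mult simp del: mult_eq_1_iff)
qed

section \<open>Linear functionals of products modulo 2\<close>

lemma frag_sum_mult:
  assumes "f \<in> carrier R" "g \<in> carrier R"
  shows "frag_sum w (f \<otimes>\<^bsub>R\<^esub> g) = frag_sum (\<lambda>x. frag_sum (\<lambda>y. \<delta> (x, y) * w (x \<otimes> y)) g) f"
proof -
  have y: "frag_sum w (frag_of x \<otimes>\<^bsub>R\<^esub> g) = frag_sum (\<lambda>y. \<delta> (x, y) * w (x \<otimes> y)) g" if "x \<in> carrier H" for x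
    using assms(2)[unfolded R_carrier]
    by (induction g rule: frag_induction)
       (simp_all add: that R_mult_diff_right R_mult_basis frag_sum_diff frag_sum_cmul)
  show ?thesis
    using assms(1)[unfolded R_carrier]
    by (induction f rule: frag_induction) (simp_all add: y R_mult_diff_left frag_sum_diff)
qed

text \<open>All cocycle values are odd, so modulo 2 the double sum for the product only sees
  \<open>w x + w y\<close>; this splits into the two terms of a Leibniz rule over the
  augmentation.\<close>

lemma frag_sum_mult_parity:
  assumes fg: "f \<in> carrier R" "g \<in> carrier R"
    and w: "\<And>x y. x \<in> carrier H \<Longrightarrow> y \<in> carrier H \<Longrightarrow> even (w (x \<otimes> y) - (w x + w y))"
  shows "even (frag_sum w (f \<otimes>\<^bsub>R\<^esub> g) - (frag_sum w f * augmentation g + augmentation f * frag_sum w g))"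
proof -
  have "even (\<delta> (x, y) * w (x \<otimes> y) - (w x + w y))" if "x \<in> carrier H" "y \<in> carrier H" for x y
    using cocycle_values[OF that] w[OF that] by auto
  then have "even (frag_sum (\<lambda>x. frag_sum (\<lambda>y. \<delta> (x, y) * w (x \<otimes> y)) g) f
      - frag_sum (\<lambda>x. frag_sum (\<lambda>y. w x + w y) g) f)"
    using fg by (intro frag_sum_parity_cong) auto
  moreover have "frag_sum (\<lambda>x. frag_sum (\<lambda>y. w x + w y) g) f
      = frag_sum w f * augmentation g + augmentation f * frag_sum w g"
    by (simp add: frag_sum_fun_add frag_sum_const mult.commute[of "augmentation g"] frag_sum_fun_cmul)
  ultimately show ?thesis by (simp add: frag_sum_mult[OF fg])
qed

text \<open>The signs of a general cocycle obstruct multiplicativity over the integers, but they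
  disappear modulo 2.\<close>

lemma augmentation_mult_parity:
  assumes fg: "f \<in> carrier R" "g \<in> carrier R"
  shows "even (augmentation (f \<otimes>\<^bsub>R\<^esub> g) - augmentation f * augmentation g)"
proof -
  have "even (\<delta> (x, y) - 1)" if "x \<in> carrier H" "y \<in> carrier H" for x y
    using cocycle_values[OF that] by auto
  then have "even (frag_sum (\<lambda>x. frag_sum (\<lambda>y. \<delta> (x, y) * 1) g) f - frag_sum (\<lambda>x. frag_sum (\<lambda>y. 1) g) f)"
    using fg by (intro frag_sum_parity_cong) auto
  moreover have "augmentation (f \<otimes>\<^bsub>R\<^esub> g) = frag_sum (\<lambda>x. frag_sum (\<lambda>y. \<delta> (x, y) * 1) g) f"
    by (simp only: augmentation_eq_frag_sum frag_sum_mult[OF fg])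
  ultimately show ?thesis by (simp add: frag_sum_const mult.commute)
qed

lemma augmentation_unit_odd:
  assumes "f \<in> Units R"
  shows "odd (augmentation f)"
proof -
  obtain g where "g \<in> carrier R" "f \<otimes>\<^bsub>R\<^esub> g = frag_of \<one>"
    using assms unfolding Units_def by auto
  then show ?thesis
    using augmentation_mult_parity[of f g] R.Units_closed[OF assms]
    by (auto simp: augmentation_def)
qed

section \<open>Coefficients of products and torsion units\<close>

lemma lookup_mult:
  assumes "f \<in> carrier R" "g \<in> carrier R"
  shows "Poly_Mapping.lookup (f \<otimes>\<^bsub>R\<^esub> g) z
    = (\<Sum>y\<in>carrier H. Poly_Mapping.lookup g y * Poly_Mapping.lookup (f \<otimes>\<^bsub>R\<^esub> frag_of y) z)"
  using assms(2)[unfolded R_carrier]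
proof (induction g rule: frag_induction)
  case (one x)
  then show ?case using fin by (simp add: if_distrib[of "\<lambda>c. c * _"] cong: if_cong)
qed (simp_all add: R_mult_diff_right lookup_minus left_diff_distrib sum_subtractf)

text \<open>Right multiplication by \<open>frag_of z\<close> permutes the basis up to the signs
  \<open>\<delta> (x, z)\<close>. With x = \<one> this gives the diagonal of the regular
  representation; with x = z an involution it moves the coefficient at \<open>z\<close> to
  \<one>.\<close>

lemma lookup_mult_basis:
  assumes "f \<in> carrier R" "x \<in> carrier H" "z \<in> carrier H"
  shows "Poly_Mapping.lookup (f \<otimes>\<^bsub>R\<^esub> frag_of z) (x \<otimes> z) = \<delta> (x, z) * Poly_Mapping.lookup f x"
  using assms(1)[unfolded R_carrier]
  by (induction f rule: frag_induction)
     (use assms(2,3) in \<open>auto simp: R_mult_diff_left lookup_minus R_mult_basis right_diff_distrib\<close>)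

text \<open>The Berman--Higman theorem, from the left regular representation \<open>L\<close>, whose trace at \<open>f\<close> is
  \<open>|H|\<close> times the coefficient of \<open>f\<close> at \<open>\<one>\<close>.\<close>

lemma torsion_unit_one_support:
  assumes f: "f \<in> carrier R" and pow: "f [^]\<^bsub>R\<^esub> (k::nat) = frag_of \<one>" and "0 < k"
    and "Poly_Mapping.lookup f \<one> \<noteq> 0"
  obtains s where "s \<in> {1, -1}" "f = frag_cmul s (frag_of \<one>)"
proof -
  define n where "n = card (carrier H)"
  obtain h where h: "bij_betw h {..<n} (carrier H)"
    using ex_bij_betw_nat_finite[OF fin] by (auto simp: n_def atLeast0LessThan)
  have hH: "h i \<in> carrier H" if "i < n" for i
    using h that by (auto simp: bij_betw_def)
  have h_eq: "h i = h j \<longleftrightarrow> i = j" if "i < n" "j < n" for i j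
    using h that by (auto simp: bij_betw_def inj_on_def)
  define L :: "('a \<Rightarrow>\<^sub>0 int) \<Rightarrow> complex mat" where
    "L g = mat n n (\<lambda>(i, j). of_int (Poly_Mapping.lookup (g \<otimes>\<^bsub>R\<^esub> frag_of (h j)) (h i)))" for g
  have L_carrier: "L g \<in> carrier_mat n n" for g by (simp add: L_def)
  \<comment> \<open>Column \<open>j\<close> of \<open>L g\<close> lists the coefficients of
    \<open>g\<close> times the basis element of \<open>h j\<close>. After reassociating,
    \<open>lookup_mult\<close> is exactly the formula for the matrix product.\<close>
  have L_mult: "L (g \<otimes>\<^bsub>R\<^esub> g') = L g * L g'" if g: "g \<in> carrier R" "g' \<in> carrier R" for g g'
  proof (rule eq_matI)
    fix i j assume "i < dim_row (L g * L g')" "j < dim_col (L g * L g')"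
    then have ij: "i < n" "j < n" by (simp_all add: L_def)
    have "Poly_Mapping.lookup (g \<otimes>\<^bsub>R\<^esub> g' \<otimes>\<^bsub>R\<^esub> frag_of (h j)) (h i)
        = Poly_Mapping.lookup (g \<otimes>\<^bsub>R\<^esub> (g' \<otimes>\<^bsub>R\<^esub> frag_of (h j))) (h i)"
      using g hH ij by (subst R_assoc) auto
    also have "\<dots> = (\<Sum>y\<in>carrier H. Poly_Mapping.lookup (g' \<otimes>\<^bsub>R\<^esub> frag_of (h j)) y
        * Poly_Mapping.lookup (g \<otimes>\<^bsub>R\<^esub> frag_of y) (h i))"
      using g hH ij by (intro lookup_mult R_closed) auto
    also have "\<dots> = (\<Sum>l<n. Poly_Mapping.lookup (g' \<otimes>\<^bsub>R\<^esub> frag_of (h j)) (h l)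
        * Poly_Mapping.lookup (g \<otimes>\<^bsub>R\<^esub> frag_of (h l)) (h i))"
      by (rule sum.reindex_bij_betw[OF h, symmetric])
    finally show "L (g \<otimes>\<^bsub>R\<^esub> g') $$ (i, j) = (L g * L g') $$ (i, j)"
      unfolding index_mult_mat_sum[OF L_carrier L_carrier ij]
      using ij by (simp add: L_def mult.commute)
  qed (auto simp: L_def)
  have L_one: "L (frag_of \<one>) = 1\<^sub>m n"
    using hH h_eq by (intro eq_matI) (auto simp: L_def R_mult_basis)
  have "L (f [^]\<^bsub>R\<^esub> p) = L f ^\<^sub>m p" for p :: nat
  proof (induction p)
    case 0
    then show ?case using L_carrier[of f] by (simp add: L_one)
  next
    case (Suc p)
    then show ?case using f R.nat_pow_closed[OF f, of p] by (simp add: L_mult)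
  qed
  then have Lpow: "L f ^\<^sub>m k = 1\<^sub>m n" using pow L_one by metis
  \<comment> \<open>Every diagonal entry is the coefficient at \<one>, since the sign
    \<open>\<delta> (\<one>, h i)\<close> is 1 by normalization.\<close>
  have "(\<Sum>i<n. L f $$ (i, i)) = (\<Sum>i<n. of_int (Poly_Mapping.lookup f \<one>))"
    using lookup_mult_basis[OF f one_closed] hH by (intro sum.cong) (auto simp: L_def)
  then have trace: "(\<Sum>i<n. L f $$ (i, i)) = of_nat n * of_int (Poly_Mapping.lookup f \<one>)"
    by simp
  define s where "s = sgn (Poly_Mapping.lookup f \<one>)"
  have Lf: "L f = of_int s \<cdot>\<^sub>m 1\<^sub>m n"
    unfolding s_def by (rule finite_order_mat_scalar[OF L_carrier Lpow \<open>0 < k\<close> trace assms(4)])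
  \<comment> \<open>The column belonging to \<one> contains the coefficients of \<open>f\<close>
    itself, so the scalar matrix determines \<open>f\<close>.\<close>
  have "f = frag_cmul s (frag_of \<one>)"
  proof (rule poly_mapping_eqI)
    fix x
    show "Poly_Mapping.lookup f x = Poly_Mapping.lookup (frag_cmul s (frag_of \<one>)) x"
    proof (cases "x \<in> carrier H")
      case True
      then have "x \<in> h ` {..<n}" using h by (simp add: bij_betw_def)
      then obtain i where i: "i < n" "h i = x" by auto
      have "\<one> \<in> h ` {..<n}" using h by (simp add: bij_betw_def)
      then obtain j where j: "j < n" "h j = \<one>" by (metis imageE lessThan_iff)
      note ij = i j
      have "L f $$ (i, j) = of_int (Poly_Mapping.lookup f x)"
        using ij f by (simp add: L_def R_r_one)
      then show ?thesis
        using ij h_eq[of i j] by (auto simp: Lf split: if_splits)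
    next
      case False
      then show ?thesis using f by (auto simp: in_keys_iff)
    qed
  qed
  moreover have "s \<in> {1, -1}" using assms(4) by (simp add: s_def sgn_if)
  ultimately show ?thesis using that by blast
qed

text \<open>Multiplying \<open>f\<close> by \<open>frag_of z\<close> moves the nonzero coefficient
  from \<open>z\<close> to \<one>. The product is again of finite order because the two factors
  commute and \<open>frag_of z\<close> has finite order, so \<open>torsion_unit_one_support\<close>
  applies to it.\<close>

lemma torsion_unit_involution_support:
  assumes f: "f \<in> carrier R" and pow: "f [^]\<^bsub>R\<^esub> (k::nat) = frag_of \<one>" and "0 < k"
    and z: "z \<in> carrier H" "z \<otimes> z = \<one>"
    and comm: "f \<otimes>\<^bsub>R\<^esub> frag_of z = frag_of z \<otimes>\<^bsub>R\<^esub> f"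
    and "Poly_Mapping.lookup f z \<noteq> 0"
  shows "f \<in> trivial_units H"
proof -
  have zR: "frag_of z \<in> carrier R" using z by simp
  let ?g = "f \<otimes>\<^bsub>R\<^esub> frag_of z"
  have gR: "?g \<in> carrier R" using R_closed[OF f zR] .
  have z2: "frag_of z \<otimes>\<^bsub>R\<^esub> frag_of z = frag_cmul (\<delta> (z, z)) (frag_of \<one>)"
    by (simp add: R_mult_basis z)
  \<comment> \<open>The exponent is 4 rather than 2 because the square of \<open>frag_of z\<close>
    is the sign \<open>\<delta> (z, z)\<close>, which may be -1.\<close>
  have "frag_of z [^]\<^bsub>R\<^esub> (4::nat) = (frag_of z [^]\<^bsub>R\<^esub> (2::nat)) [^]\<^bsub>R\<^esub> (2::nat)"
    using R.nat_pow_pow[OF zR, of 2 2] by simp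
  also have "frag_of z [^]\<^bsub>R\<^esub> (2::nat) = frag_cmul (\<delta> (z, z)) (frag_of \<one>)"
    using z zR R_l_one by (simp add: numeral_2_eq_2 z2)
  also have "\<dots> [^]\<^bsub>R\<^esub> (2::nat) = frag_of \<one>"
    using z R_l_one cocycle_square[of z z] cocycle_values[of z z]
    by (auto simp: numeral_2_eq_2 R_mult_cmul_left R_mult_cmul_right)
  finally have z4: "frag_of z [^]\<^bsub>R\<^esub> (4::nat) = frag_of \<one>" .
  have "?g [^]\<^bsub>R\<^esub> (4 * k) = f [^]\<^bsub>R\<^esub> (k * 4) \<otimes>\<^bsub>R\<^esub> frag_of z [^]\<^bsub>R\<^esub> (4 * k)"
    using R.pow_mult_distrib[OF comm f zR] by (simp add: mult.commute)
  also have "\<dots> = frag_of \<one>"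
    using R.nat_pow_pow[OF f, of k 4] R.nat_pow_pow[OF zR, of 4 k] pow z4
      R.nat_pow_one R_one R_l_one[of "frag_of \<one>"] by simp
  finally have "?g [^]\<^bsub>R\<^esub> (4 * k) = frag_of \<one>" .
  moreover have "Poly_Mapping.lookup ?g \<one> \<noteq> 0"
    using lookup_mult_basis[OF f z(1) z(1)] z cocycle_values[of z z] assms(7) by auto
  ultimately obtain s where s: "s \<in> {1, -1}" "?g = frag_cmul s (frag_of \<one>)"
    using torsion_unit_one_support[OF gR, of "4 * k"] \<open>0 < k\<close> by auto
  \<comment> \<open>Multiplying \<open>?g\<close> once more by \<open>frag_of z\<close> returns
    \<open>f\<close> up to the sign \<open>\<delta> (z, z)\<close>, which is then cancelled against
    itself.\<close>
  have "frag_cmul (\<delta> (z, z)) f = f \<otimes>\<^bsub>R\<^esub> (frag_of z \<otimes>\<^bsub>R\<^esub> frag_of z)"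
    by (simp add: z2 R_mult_cmul_right R_r_one[OF f])
  also have "\<dots> = frag_cmul s (frag_of z)"
    using R_assoc[OF f zR zR] s z by (simp add: R_mult_cmul_left R_mult_basis)
  finally have "frag_cmul (\<delta> (z, z) * \<delta> (z, z)) f = frag_cmul (\<delta> (z, z) * s) (frag_of z)"
    by (metis frag_cmul_cmul)
  then have "f = frag_cmul (\<delta> (z, z) * s) (frag_of z)"
    using cocycle_square[of z z] z by simp
  moreover have "\<delta> (z, z) * s \<in> {1, -1}"
    using s cocycle_values[of z z] z by auto
  ultimately show ?thesis using z unfolding trivial_units_eq by blast
qed

end

section \<open>Inflation from \<open>G\<close> to \<open>G \<times> C\<^sub>2\<^sup>m\<close>\<close>

text \<open>The new complement is the preimage of M \<times> 1 under the pair (\<epsilon>, \<chi>).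
  Injectivity of this pair on \<open>S'\<close> gives the trivial intersection, and its surjectivity
  onto \<open>S \<times> carrier C\<close> gives the factorization.\<close>

lemma internal_semidirect_product_pullback:
  assumes "group U" "group V" "group C"
    and \<epsilon>: "\<epsilon> \<in> hom U V" and \<chi>: "\<chi> \<in> hom U C" and S': "subgroup S' U"
    and bij: "bij_betw (\<lambda>s. (\<epsilon> s, \<chi> s)) S' (S \<times> carrier C)"
    and "internal_semidirect_product V M S"
  shows "internal_semidirect_product U {a \<in> carrier U. \<epsilon> a \<in> M \<and> \<chi> a = \<one>\<^bsub>C\<^esub>} S'"
proof -
  interpret U: group U by fact
  interpret V: group V by fact
  interpret C: group C by fact
  interpret \<epsilon>: group_hom U V \<epsilon> using \<epsilon> by unfold_locales
  interpret \<chi>: group_hom U C \<chi> using \<chi> by unfold_locales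
  interpret S': subgroup S' U by fact
  have M: "M \<lhd> V" and S: "subgroup S V" and MS: "M \<inter> S = {\<one>\<^bsub>V\<^esub>}" and prod: "M <#>\<^bsub>V\<^esub> S = carrier V"
    using assms(8) by (auto simp: internal_semidirect_product_def)
  interpret M: normal M V by (rule M)
  let ?N = "{a \<in> carrier U. \<epsilon> a \<in> M \<and> \<chi> a = \<one>\<^bsub>C\<^esub>}"
  have N: "subgroup ?N U"
    by (rule subgroup.intro) auto
  have "?N \<lhd> U"
    unfolding U.normal_inv_iff using N M.inv_op_closed2 by auto
  moreover have "?N \<inter> S' = {\<one>\<^bsub>U\<^esub>}"
  proof (intro equalityI subsetI)
    fix a assume a: "a \<in> ?N \<inter> S'"
    then have "\<epsilon> a \<in> S" using bij by (auto simp: bij_betw_def)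
    then have "(\<epsilon> a, \<chi> a) = (\<epsilon> \<one>\<^bsub>U\<^esub>, \<chi> \<one>\<^bsub>U\<^esub>)" using a MS by auto
    then have "a = \<one>\<^bsub>U\<^esub>" using bij a S'.one_closed by (auto simp: bij_betw_def inj_on_def)
    then show "a \<in> {\<one>\<^bsub>U\<^esub>}" by simp
  qed auto
  moreover have "?N <#>\<^bsub>U\<^esub> S' = carrier U"
  proof (intro equalityI subsetI)
    fix a assume a: "a \<in> carrier U"
    then have "\<epsilon> a \<in> M <#>\<^bsub>V\<^esub> S" using prod by simp
    then obtain m t where mt: "m \<in> M" "t \<in> S" "\<epsilon> a = m \<otimes>\<^bsub>V\<^esub> t" by (auto simp: set_mult_def)
    \<comment> \<open>The factor from \<open>S'\<close> must match \<open>a\<close> in both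
      respects: the \<open>S\<close>-part of \<epsilon> a and the value \<chi> a. Dividing it out
      leaves an element of the preimage.\<close>
    then have "(t, \<chi> a) \<in> (\<lambda>s. (\<epsilon> s, \<chi> s)) ` S'"
      using bij a by (auto simp: bij_betw_def)
    then obtain s where s: "s \<in> S'" "\<epsilon> s = t" "\<chi> s = \<chi> a" by auto
    have sU: "s \<in> carrier U" using s by simp
    have tV: "t \<in> carrier V" using mt S subgroup.subset by blast
    have "\<epsilon> (a \<otimes>\<^bsub>U\<^esub> inv\<^bsub>U\<^esub> s) = m"
      using a sU s mt tV M.subset by (auto simp: V.m_assoc)
    moreover have "\<chi> (a \<otimes>\<^bsub>U\<^esub> inv\<^bsub>U\<^esub> s) = \<one>\<^bsub>C\<^esub>"
      using a sU s by simp
    ultimately have "a \<otimes>\<^bsub>U\<^esub> inv\<^bsub>U\<^esub> s \<in> ?N" using a sU mt by simp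
    moreover have "a = (a \<otimes>\<^bsub>U\<^esub> inv\<^bsub>U\<^esub> s) \<otimes>\<^bsub>U\<^esub> s" using a sU by (simp add: U.m_assoc)
    ultimately show "a \<in> ?N <#>\<^bsub>U\<^esub> S'" using s unfolding set_mult_def by blast
  qed (auto simp: set_mult_def)
  ultimately show ?thesis using S' by (simp add: internal_semidirect_product_def)
qed

section \<open>The elementary abelian group \<open>C2_power m\<close>\<close>

lemma C2_power_carrier: "carrier (C2_power m) = {..<m} \<rightarrow>\<^sub>E {0, 1}"
proof -
  have "{0..<2} = {0, 1::int}" by auto
  then show ?thesis by (simp add: C2_power_def carrier_integer_mod_group)
qed

lemma C2_power_mult: "x \<otimes>\<^bsub>C2_power m\<^esub> y = (\<lambda>i\<in>{..<m}. (x i + y i) mod 2)"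
  by (simp add: C2_power_def)

lemma C2_power_one: "\<one>\<^bsub>C2_power m\<^esub> = (\<lambda>i\<in>{..<m}. 0)"
  by (simp add: C2_power_def)

lemma C2_power_group: "group (C2_power m)"
  by (simp add: C2_power_def)

lemma C2_power_finite: "finite (carrier (C2_power m))"
  by (simp add: C2_power_carrier finite_PiE)

lemma C2_power_comm: "x \<otimes>\<^bsub>C2_power m\<^esub> y = y \<otimes>\<^bsub>C2_power m\<^esub> x"
  by (simp add: C2_power_mult add.commute)

lemma C2_power_square: "x \<otimes>\<^bsub>C2_power m\<^esub> x = \<one>\<^bsub>C2_power m\<^esub>"
  by (auto simp: C2_power_mult C2_power_one)

lemma C2_power_eqI:
  assumes "x \<in> carrier (C2_power m)" "y \<in> carrier (C2_power m)"
    and "\<And>i. i < m \<Longrightarrow> x i mod 2 = y i mod 2"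
  shows "x = y"
proof (rule PiE_ext)
  show "x \<in> {..<m} \<rightarrow>\<^sub>E {0, 1}" "y \<in> {..<m} \<rightarrow>\<^sub>E {0, 1}"
    using assms by (simp_all add: C2_power_carrier)
  then show "x i = y i" if "i \<in> {..<m}" for i
    using assms(3)[of i] that by (force dest!: PiE_mem)
qed

text \<open>The parameter \<open>c\<close> is the cochain whose coboundary relates \<gamma> to the
  inflation of \<delta>, so any representative of the inflated class is covered. The constant
  cochain 1 gives the case of ordinary group rings.\<close>

locale inflated_twisted_rings = G: group G + base: twisted_ring G \<delta> + top: twisted_ring "G \<times>\<times> C2_power m" \<gamma>
  for G :: "('a, 'b) monoid_scheme" (structure) and m :: nat
    and \<delta> :: "'a \<times> 'a \<Rightarrow> int"
    and \<gamma> :: "('a \<times> (nat \<Rightarrow> int)) \<times> ('a \<times> (nat \<Rightarrow> int)) \<Rightarrow> int" +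
  fixes c :: "'a \<times> (nat \<Rightarrow> int) \<Rightarrow> int"
  assumes c_values: "x \<in> carrier (G \<times>\<times> C2_power m) \<Longrightarrow> c x \<in> {1, -1}"
    and c_one: "c \<one>\<^bsub>G \<times>\<times> C2_power m\<^esub> = 1"
    and twist: "x \<in> carrier (G \<times>\<times> C2_power m) \<Longrightarrow> y \<in> carrier (G \<times>\<times> C2_power m) \<Longrightarrow>
      \<gamma> (x, y) = c x * c y * c (x \<otimes>\<^bsub>G \<times>\<times> C2_power m\<^esub> y) * \<delta> (fst x, fst y)"
begin

abbreviation "E \<equiv> C2_power m"
abbreviation "K \<equiv> G \<times>\<times> E"

section \<open>The homomorphisms \<open>proj\<close> and \<open>parity\<close>\<close>

definition proj where
  "proj = frag_extend (\<lambda>x. frag_cmul (c x) (frag_of (fst x)))"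

definition parity where
  "parity f = (\<lambda>i\<in>{..<m}. frag_sum (\<lambda>x. snd x i) f mod 2)"

lemma c_square: "x \<in> carrier K \<Longrightarrow> c x * c x = 1"
  using c_values[of x] by auto

lemma proj_closed:
  assumes "f \<in> carrier top.R"
  shows "proj f \<in> carrier base.R"
proof -
  have "Poly_Mapping.keys (proj f) \<subseteq> (\<Union>x\<in>Poly_Mapping.keys f. Poly_Mapping.keys (frag_cmul (c x) (frag_of (fst x))))"
    unfolding proj_def by (rule keys_frag_extend)
  also have "\<dots> \<subseteq> carrier G" using assms by auto
  finally show ?thesis by simp
qed

lemma proj_one: "proj (frag_of \<one>\<^bsub>K\<^esub>) = frag_of \<one>"
  by (simp only: proj_def frag_extend_of c_one) simp

lemma proj_0: "proj 0 = 0"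
  by (simp add: proj_def)

lemma proj_diff: "proj (f - g) = proj f - proj g"
  by (simp add: proj_def frag_extend_diff)

text \<open>On basis elements, the factor \<open>c\<close> at the product that \<open>proj\<close>
  introduces cancels the same factor in the coboundary, leaving
  \<open>c x * c y * \<delta> (fst x, fst y)\<close>. Biadditivity extends this to all
  elements.\<close>

lemma proj_mult:
  assumes f: "f \<in> carrier top.R" and g: "g \<in> carrier top.R"
  shows "proj (f \<otimes>\<^bsub>top.R\<^esub> g) = proj f \<otimes>\<^bsub>base.R\<^esub> proj g"
proof -
  have basis: "proj (frag_of x \<otimes>\<^bsub>top.R\<^esub> frag_of y) = proj (frag_of x) \<otimes>\<^bsub>base.R\<^esub> proj (frag_of y)"
    if xy: "x \<in> carrier K" "y \<in> carrier K" for x y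
  proof -
    have "\<gamma> (x, y) * c (x \<otimes>\<^bsub>K\<^esub> y) = c x * c y * \<delta> (fst x, fst y) * (c (x \<otimes>\<^bsub>K\<^esub> y) * c (x \<otimes>\<^bsub>K\<^esub> y))"
      using twist[OF xy] by (simp add: mult_ac)
    then have "\<gamma> (x, y) * c (x \<otimes>\<^bsub>K\<^esub> y) = c x * c y * \<delta> (fst x, fst y)"
      using c_square[OF top.m_closed[OF xy]] by simp
    moreover have "fst (x \<otimes>\<^bsub>K\<^esub> y) = fst x \<otimes> fst y" by (simp add: DirProd_def split: prod.split)
    ultimately show ?thesis
      by (simp only: proj_def top.R_mult_basis base.R_mult_basis frag_extend_cmul frag_extend_of frag_cmul_cmul
          base.R_mult_cmul_left base.R_mult_cmul_right mult_ac)
  qed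
  have y: "proj (frag_of x \<otimes>\<^bsub>top.R\<^esub> g) = proj (frag_of x) \<otimes>\<^bsub>base.R\<^esub> proj g" if "x \<in> carrier K" for x
    using g[unfolded top.R_carrier]
    by (induction g rule: frag_induction)
       (simp_all only: basis that proj_0 proj_diff top.R_mult_diff_right base.R_mult_diff_right
          top.R_mult_0 base.R_mult_0)
  show ?thesis
    using f[unfolded top.R_carrier]
    by (induction f rule: frag_induction)
       (simp_all only: y proj_0 proj_diff top.R_mult_diff_left base.R_mult_diff_left
          top.R_mult_0 base.R_mult_0)
qed

lemma proj_Units:
  assumes "f \<in> Units top.R"
  shows "proj f \<in> Units base.R"
proof -
  obtain g where "f \<in> carrier top.R" "g \<in> carrier top.R"
    "f \<otimes>\<^bsub>top.R\<^esub> g = frag_of \<one>\<^bsub>K\<^esub>" "g \<otimes>\<^bsub>top.R\<^esub> f = frag_of \<one>\<^bsub>K\<^esub>"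
    using assms by (auto simp: Units_def simp del: one_DirProd)
  then have "proj f \<otimes>\<^bsub>base.R\<^esub> proj g = frag_of \<one>" "proj g \<otimes>\<^bsub>base.R\<^esub> proj f = frag_of \<one>"
    "proj f \<in> carrier base.R" "proj g \<in> carrier base.R"
    using proj_mult proj_one proj_closed by metis+
  then show ?thesis by (auto simp: Units_def)
qed

lemma proj_hom: "proj \<in> hom (twisted_units K \<gamma>) (twisted_units G \<delta>)"
  using proj_Units proj_mult[OF top.R.Units_closed top.R.Units_closed]
  by (auto simp: hom_def top.U_carrier base.U_carrier top.U_mult base.U_mult)

lemma parity_closed: "parity f \<in> carrier E"
  by (auto simp: parity_def C2_power_carrier)

lemma parity_hom: "parity \<in> hom (twisted_units K \<gamma>) E"
proof (rule homI)
  fix f g assume "f \<in> carrier (twisted_units K \<gamma>)" "g \<in> carrier (twisted_units K \<gamma>)"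
  then have f: "f \<in> carrier top.R" "odd (augmentation f)" and g: "g \<in> carrier top.R" "odd (augmentation g)"
    using top.augmentation_unit_odd top.R.Units_closed by (auto simp only: top.U_carrier)
  show "parity (f \<otimes>\<^bsub>twisted_units K \<gamma>\<^esub> g) = parity f \<otimes>\<^bsub>E\<^esub> parity g"
  proof (rule C2_power_eqI)
    fix i assume i: "i < m"
    have "snd (x \<otimes>\<^bsub>K\<^esub> y) i = (snd x i + snd y i) mod 2" for x y
      using i by (simp add: DirProd_def C2_power_mult split: prod.split)
    then have "even (snd (x \<otimes>\<^bsub>K\<^esub> y) i - (snd x i + snd y i))" for x y
      by presburger
    then have "even (frag_sum (\<lambda>x. snd x i) (f \<otimes>\<^bsub>top.R\<^esub> g) -
        (frag_sum (\<lambda>x. snd x i) f * augmentation g + augmentation f * frag_sum (\<lambda>x. snd x i) g))"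
      using top.frag_sum_mult_parity[OF f(1) g(1), of "\<lambda>x. snd x i"] by blast
    \<comment> \<open>Units have odd augmentation, so the augmentations disappear from the Leibniz
      rule modulo 2 and it becomes additivity.\<close>
    then have "even (frag_sum (\<lambda>x. snd x i) (f \<otimes>\<^bsub>top.R\<^esub> g) -
        (frag_sum (\<lambda>x. snd x i) f + frag_sum (\<lambda>x. snd x i) g))"
      using f(2) g(2) by auto
    then have "frag_sum (\<lambda>x. snd x i) (f \<otimes>\<^bsub>top.R\<^esub> g) mod 2 =
        (frag_sum (\<lambda>x. snd x i) f + frag_sum (\<lambda>x. snd x i) g) mod 2"
      by presburger
    then show "parity (f \<otimes>\<^bsub>twisted_units K \<gamma>\<^esub> g) i mod 2 = (parity f \<otimes>\<^bsub>E\<^esub> parity g) i mod 2"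
      using i by (simp add: parity_def C2_power_mult top.U_mult mod_simps)
  qed (auto intro!: parity_closed monoid.m_closed group.is_monoid C2_power_group)
qed (rule parity_closed)

lemma proj_trivial: "proj (frag_cmul s (frag_of x)) = frag_cmul (s * c x) (frag_of (fst x))"
  by (simp add: proj_def frag_extend_cmul)

text \<open>The sign \<open>s\<close> is odd, hence invisible modulo 2.\<close>

lemma parity_trivial:
  assumes "s \<in> {1, -1}" "x \<in> carrier K"
  shows "parity (frag_cmul s (frag_of x)) = snd x"
proof (rule C2_power_eqI)
  show "snd x \<in> carrier E" using assms by (auto simp: DirProd_def)
  fix i assume "i < m"
  have "even (s - 1)" using assms by auto
  then have "even (s * snd x i - snd x i)" by (metis dvd_mult2 left_diff_distrib mult_1)
  then have "s * snd x i mod 2 = snd x i mod 2" by presburger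
  then show "parity (frag_cmul s (frag_of x)) i mod 2 = snd x i mod 2"
    using \<open>i < m\<close> by (simp add: parity_def frag_sum_cmul frag_sum_uminus)
qed (rule parity_closed)

text \<open>\<open>parity\<close> reads off the component in \<open>E\<close> whatever the sign;
  \<open>proj\<close> then yields the component in \<open>G\<close> and the sign up to the known
  factor \<open>c x\<close>.\<close>

lemma trivial_units_bij:
  "bij_betw (\<lambda>f. (proj f, parity f)) (trivial_units K) (trivial_units G \<times> carrier E)"
proof (rule bij_betw_imageI)
  show "inj_on (\<lambda>f. (proj f, parity f)) (trivial_units K)"
  proof (rule inj_onI)
    fix f g assume "f \<in> trivial_units K" "g \<in> trivial_units K"
      and eq: "(proj f, parity f) = (proj g, parity g)"
    then obtain s x t y where f: "f = frag_cmul s (frag_of x)" "s \<in> {1, -1}" "x \<in> carrier K"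
      and g: "g = frag_cmul t (frag_of y)" "t \<in> {1, -1}" "y \<in> carrier K"
      unfolding top.trivial_units_eq by blast
    have "snd x = snd y" using eq f g parity_trivial by simp
    have p: "frag_cmul (s * c x) (frag_of (fst x)) = frag_cmul (t * c y) (frag_of (fst y))"
      using eq f g by (simp add: proj_trivial)
    have "s * c x \<noteq> 0" "t * c y \<noteq> 0" using f g c_values[of x] c_values[of y] by auto
    then have "Poly_Mapping.keys (frag_cmul (s * c x) (frag_of (fst x))) = {fst x}"
       "Poly_Mapping.keys (frag_cmul (t * c y) (frag_of (fst y))) = {fst y}" by auto
    then have "fst x = fst y" using p by simp
    with \<open>snd x = snd y\<close> have "x = y" by (rule prod_eqI[rotated])
    have "s * c x = t * c y"
      using arg_cong[OF p, of "\<lambda>f. Poly_Mapping.lookup f (fst x)"] \<open>fst x = fst y\<close> by simp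
    then show "f = g" using f g \<open>x = y\<close> c_values[of x] by auto
  qed
  show "(\<lambda>f. (proj f, parity f)) ` trivial_units K = trivial_units G \<times> carrier E"
  proof (intro equalityI subsetI)
    fix p assume "p \<in> (\<lambda>f. (proj f, parity f)) ` trivial_units K"
    then obtain s x where "p = (proj (frag_cmul s (frag_of x)), parity (frag_cmul s (frag_of x)))"
      and sx: "s \<in> {1, -1}" "x \<in> carrier K"
      unfolding top.trivial_units_eq by blast
    moreover have "s * c x \<in> {1, -1}" using sx c_values[of x] by auto
    moreover have "fst x \<in> carrier G" using sx by (auto simp: DirProd_def)
    ultimately show "p \<in> trivial_units G \<times> carrier E"
      unfolding base.trivial_units_eq proj_trivial using parity_closed by blast
  next
    fix p assume "p \<in> trivial_units G \<times> carrier E"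
    then obtain s x e where p: "p = (frag_cmul s (frag_of x), e)" "s \<in> {1, -1}" "x \<in> carrier G" "e \<in> carrier E"
      unfolding base.trivial_units_eq by blast
    then have xe: "(x, e) \<in> carrier K" by (simp add: DirProd_def)
    \<comment> \<open>The additional factor \<open>c (x, e)\<close> compensates the one introduced
      by \<open>proj\<close>.\<close>
    let ?f = "frag_cmul (s * c (x, e)) (frag_of (x, e))"
    have s: "s * c (x, e) \<in> {1, -1}" using p c_values[OF xe] by auto
    have "proj ?f = frag_cmul s (frag_of x)"
      using c_square[OF xe] by (simp add: proj_trivial mult.assoc)
    moreover have "parity ?f = e" using parity_trivial[OF s xe] by simp
    moreover have "?f \<in> trivial_units K" using s xe unfolding top.trivial_units_eq by blast
    ultimately show "p \<in> (\<lambda>f. (proj f, parity f)) ` trivial_units K"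
      using p(1) by (intro image_eqI[where x = ?f]) simp_all
  qed
qed

section \<open>Torsion in the joint kernel of \<open>proj\<close> and \<open>parity\<close>\<close>

lemma C2_power_central:
  assumes f: "f \<in> carrier top.R" and e: "e \<in> carrier E"
  shows "f \<otimes>\<^bsub>top.R\<^esub> frag_of (\<one>, e) = frag_of (\<one>, e) \<otimes>\<^bsub>top.R\<^esub> f"
proof -
  have z: "(\<one>, e) \<in> carrier K" using e by (simp add: DirProd_def)
  have basis: "frag_of x \<otimes>\<^bsub>top.R\<^esub> frag_of (\<one>, e) = frag_of (\<one>, e) \<otimes>\<^bsub>top.R\<^esub> frag_of x" if x: "x \<in> carrier K" for x
  proof -
    have fst: "fst x \<in> carrier G" using x by (auto simp: DirProd_def)
    have "x \<otimes>\<^bsub>K\<^esub> (\<one>, e) = (\<one>, e) \<otimes>\<^bsub>K\<^esub> x"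
      using fst by (cases x) (simp add: C2_power_comm)
    \<comment> \<open>The coboundary of \<open>c\<close> is symmetric on commuting pairs, and
      \<delta> contributes 1 on both sides because it is normalized.\<close>
    moreover have "\<gamma> (x, (\<one>, e)) = \<gamma> ((\<one>, e), x)"
      using twist[OF x z] twist[OF z x] calculation fst by (simp add: mult.commute)
    ultimately show ?thesis by (simp only: top.R_mult_basis)
  qed
  show ?thesis
    using f[unfolded top.R_carrier]
    by (induction f rule: frag_induction)
       (simp_all only: basis top.R_mult_diff_left top.R_mult_diff_right top.R_mult_0)
qed

lemma torsion_kernel_trivial:
  assumes f: "f \<in> Units top.R" and pow: "f [^]\<^bsub>top.R\<^esub> (k::nat) = frag_of \<one>\<^bsub>K\<^esub>" "0 < k"
    and proj: "proj f = frag_of \<one>" and parity: "parity f = \<one>\<^bsub>E\<^esub>"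
  shows "f = frag_of \<one>\<^bsub>K\<^esub>"
proof -
  have fR: "f \<in> carrier top.R" using f by (rule top.R.Units_closed)
  \<comment> \<open>The support of \<open>proj f\<close> contains \<one>, so some \<open>x\<close>
    in the support of \<open>f\<close> lies above it; such an \<open>x\<close> squares to the
    identity.\<close>
  have "\<one> \<in> Poly_Mapping.keys (proj f)" using proj by simp
  also have "Poly_Mapping.keys (proj f)
      \<subseteq> (\<Union>x\<in>Poly_Mapping.keys f. Poly_Mapping.keys (frag_cmul (c x) (frag_of (fst x))))"
    unfolding proj_def by (rule keys_frag_extend)
  finally obtain x where x: "x \<in> Poly_Mapping.keys f" "\<one> \<in> Poly_Mapping.keys (frag_cmul (c x) (frag_of (fst x)))"
    by blast
  then have x1: "fst x = \<one>" by (simp split: if_splits)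
  have xK: "x \<in> carrier K" using x fR unfolding top.R_carrier by blast
  then have e: "snd x \<in> carrier E" by (auto simp: DirProd_def)
  have z: "x = (\<one>, snd x)" using x1 by (metis prod.collapse)
  have "x \<otimes>\<^bsub>K\<^esub> x = \<one>\<^bsub>K\<^esub>"
    by (subst (1 2) z) (simp add: C2_power_square)
  moreover have "f \<otimes>\<^bsub>top.R\<^esub> frag_of x = frag_of x \<otimes>\<^bsub>top.R\<^esub> f"
    using C2_power_central[OF fR e] z by metis
  moreover have "Poly_Mapping.lookup f x \<noteq> 0" using x by (simp add: in_keys_iff)
  ultimately have "f \<in> trivial_units K"
    using top.torsion_unit_involution_support[OF fR pow xK] by blast
  moreover have one: "frag_of \<one>\<^bsub>K\<^esub> \<in> trivial_units K"
    using subgroup.one_closed[OF top.trivial_units_subgroup] by (simp only: top.U_one)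
  moreover have "parity (frag_of \<one>\<^bsub>K\<^esub>) = \<one>\<^bsub>E\<^esub>"
    using parity_trivial[of 1 "\<one>\<^bsub>K\<^esub>"] top.one_closed by simp
  \<comment> \<open>Among trivial units the pair (\<open>proj\<close>, \<open>parity\<close>) is
    injective, and \<open>f\<close> has the same values as the identity.\<close>
  ultimately show ?thesis
    by (intro inj_onD[OF bij_betw_imp_inj_on[OF trivial_units_bij]])
       (simp_all only: proj parity proj_one)
qed

section \<open>Transfer of normal complements\<close>

lemma normal_complement_pullback:
  assumes "internal_semidirect_product (twisted_units G \<delta>) M (trivial_units G)"
  shows "internal_semidirect_product (twisted_units K \<gamma>)
    {f \<in> carrier (twisted_units K \<gamma>). proj f \<in> M \<and> parity f = \<one>\<^bsub>E\<^esub>} (trivial_units K)"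
  using internal_semidirect_product_pullback[OF top.U.is_group base.U.is_group C2_power_group
      proj_hom parity_hom top.trivial_units_subgroup trivial_units_bij assms] .

lemma has_normal_complement_inflated:
  "has_normal_complement G \<delta> \<Longrightarrow> has_normal_complement K \<gamma>"
  unfolding has_normal_complement_def using normal_complement_pullback by blast

lemma has_torsion_free_normal_complement_inflated:
  assumes "has_torsion_free_normal_complement G \<delta>"
  shows "has_torsion_free_normal_complement K \<gamma>"
proof -
  obtain M where M: "internal_semidirect_product (twisted_units G \<delta>) M (trivial_units G)"
    and tf: "torsion_free ((twisted_units G \<delta>)\<lparr>carrier := M\<rparr>)"
    using assms unfolding has_torsion_free_normal_complement_def by blast
  interpret proj: group_hom "twisted_units K \<gamma>" "twisted_units G \<delta>" proj
    using proj_hom by unfold_locales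
  let ?N = "{f \<in> carrier (twisted_units K \<gamma>). proj f \<in> M \<and> parity f = \<one>\<^bsub>E\<^esub>}"
  have "torsion_free ((twisted_units K \<gamma>)\<lparr>carrier := ?N\<rparr>)"
    unfolding torsion_free_def
  proof (intro ballI allI impI)
    fix f and k :: nat
    assume "f \<in> carrier ((twisted_units K \<gamma>)\<lparr>carrier := ?N\<rparr>)" and k: "0 < k"
      and "f [^]\<^bsub>(twisted_units K \<gamma>)\<lparr>carrier := ?N\<rparr>\<^esub> k = \<one>\<^bsub>(twisted_units K \<gamma>)\<lparr>carrier := ?N\<rparr>\<^esub>"
    then have f: "f \<in> carrier (twisted_units K \<gamma>)" "proj f \<in> M" "parity f = \<one>\<^bsub>E\<^esub>"
      and pow: "f [^]\<^bsub>twisted_units K \<gamma>\<^esub> k = \<one>\<^bsub>twisted_units K \<gamma>\<^esub>"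
      by (auto simp: nat_pow_def)
    \<comment> \<open>The projection of a torsion element is torsion in \<open>M\<close>, hence
      trivial; this places the element in the joint kernel.\<close>
    have "proj f [^]\<^bsub>twisted_units G \<delta>\<^esub> k = \<one>\<^bsub>twisted_units G \<delta>\<^esub>"
      using pow f proj.hom_nat_pow[of f k] proj.hom_one by metis
    then have "proj f = \<one>\<^bsub>twisted_units G \<delta>\<^esub>"
      using tf f(2) k by (simp add: torsion_free_def nat_pow_def)
    then have "f = frag_of \<one>\<^bsub>K\<^esub>"
      using torsion_kernel_trivial[of f k] f pow k
      by (simp only: top.U_carrier top.U_pow top.U_one base.U_one)
    then show "f = \<one>\<^bsub>(twisted_units K \<gamma>)\<lparr>carrier := ?N\<rparr>\<^esub>"
      by (simp only: top.U_one monoid.simps partial_object.simps)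
       (simp add: top.U_one)
  qed
  then show ?thesis
    unfolding has_torsion_free_normal_complement_def using normal_complement_pullback[OF M] by blast
qed

end

section \<open>The Higman subgroup property and the theorem\<close>

lemma injective_hom_iso_subgroup:
  assumes "group W" "group V" and f: "f \<in> hom W V"
    and ker: "\<And>a. a \<in> carrier W \<Longrightarrow> f a = \<one>\<^bsub>V\<^esub> \<Longrightarrow> a = \<one>\<^bsub>W\<^esub>"
  shows "\<exists>L. subgroup L V \<and> W \<cong> V\<lparr>carrier := L\<rparr>"
proof -
  interpret group_hom W V f
    using assms by (simp add: group_hom_def group_hom_axioms_def)
  have "inj_on f (carrier W)"
    using ker by (simp add: inj_on_one_iff)
  then have "f \<in> iso W (V\<lparr>carrier := f ` carrier W\<rparr>)"
    by (auto simp: iso_def hom_def bij_betw_def)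
  then show ?thesis using img_is_subgroup by (auto simp: is_iso_def)
qed

section \<open>Normalized units of the ordinary group ring\<close>

lemma trivial_cocycle:
  assumes "group H"
  shows "\<one>\<^bsub>cocycles2 H\<^esub> \<in> carrier (cocycles2 H)"
proof -
  interpret group H by fact
  show ?thesis by (auto simp: cocycles2_def)
qed

lemma trivial_cocycle_apply:
  "x \<in> carrier H \<Longrightarrow> y \<in> carrier H \<Longrightarrow> \<one>\<^bsub>cocycles2 H\<^esub> (x, y) = 1"
  by (simp add: cocycles2_def)

lemma normalized_units_eq:
  "normalized_units H =
    (twisted_units H \<one>\<^bsub>cocycles2 H\<^esub>)\<lparr>carrier := {f \<in> carrier (twisted_units H \<one>\<^bsub>cocycles2 H\<^esub>). augmentation f = 1}\<rparr>"
  by (simp add: normalized_units_def twisted_units_def group_ring_def units_of_def)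

text \<open>For the trivial cocycle the augmentation is multiplicative over the integers, not only
  modulo 2.\<close>

lemma normalized_units_subgroup:
  assumes "group H" "finite (carrier H)"
  shows "subgroup (carrier (normalized_units H)) (twisted_units H \<one>\<^bsub>cocycles2 H\<^esub>)"
proof -
  interpret twisted_ring H "\<one>\<^bsub>cocycles2 H\<^esub>"
    using assms trivial_cocycle by (simp add: twisted_ring_def twisted_ring_axioms_def)
  have aug_mult: "augmentation (f \<otimes>\<^bsub>R\<^esub> g) = augmentation f * augmentation g"
    if fg: "f \<in> Units R" "g \<in> Units R" for f g
  proof -
    note c = R.Units_closed[OF fg(1)] R.Units_closed[OF fg(2)]
    have "augmentation (f \<otimes>\<^bsub>R\<^esub> g) = frag_sum (\<lambda>x. frag_sum (\<lambda>y. \<one>\<^bsub>cocycles2 H\<^esub> (x, y) * 1) g) f"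
      by (simp only: augmentation_eq_frag_sum frag_sum_mult[OF c])
    also have "\<dots> = frag_sum (\<lambda>x. frag_sum (\<lambda>y. 1) g) f"
      using c by (intro frag_sum_cong) (auto intro!: trivial_cocycle_apply)
    finally show ?thesis by (simp add: frag_sum_const)
  qed
  have aug_one: "augmentation (frag_of \<one>\<^bsub>H\<^esub>) = 1" by (simp add: augmentation_def)
  show ?thesis
  proof (rule subgroup.intro)
    fix f assume "f \<in> carrier (normalized_units H)"
    then have f: "f \<in> carrier (twisted_units H \<one>\<^bsub>cocycles2 H\<^esub>)" "augmentation f = 1"
      by (simp_all add: normalized_units_eq)
    let ?g = "inv\<^bsub>twisted_units H \<one>\<^bsub>cocycles2 H\<^esub>\<^esub> f"
    have g: "?g \<in> carrier (twisted_units H \<one>\<^bsub>cocycles2 H\<^esub>)" using f by simp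
    have "augmentation (f \<otimes>\<^bsub>R\<^esub> ?g) = 1"
      using U.r_inv[OF f(1)] by (simp add: U_mult U_one aug_one)
    then have "augmentation ?g = 1"
      using f g aug_mult[of f ?g] by (simp add: U_carrier)
    then show "?g \<in> carrier (normalized_units H)" using g by (simp add: normalized_units_eq)
  qed (use aug_mult aug_one U.m_closed U.one_closed in \<open>auto simp: normalized_units_eq U_carrier U_mult U_one\<close>)
qed

lemma normalized_units_group:
  assumes "group H" "finite (carrier H)"
  shows "group (normalized_units H)"
proof -
  interpret twisted_ring H "\<one>\<^bsub>cocycles2 H\<^esub>"
    using assms trivial_cocycle by (simp add: twisted_ring_def twisted_ring_axioms_def)
  have "(twisted_units H \<one>\<^bsub>cocycles2 H\<^esub>)\<lparr>carrier := carrier (normalized_units H)\<rparr> = normalized_units H"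
    by (simp add: normalized_units_eq)
  then show ?thesis
    using U.subgroup_imp_group[OF normalized_units_subgroup[OF assms]] by simp
qed

lemma pow_carrier_update [simp]: "a [^]\<^bsub>W\<lparr>carrier := S\<rparr>\<^esub> (n::nat) = a [^]\<^bsub>W\<^esub> n"
  by (simp add: nat_pow_def)

text \<open>For a finite subgroup \<open>W\<close>, the hypothesis on \<open>G\<close> embeds
  \<open>proj\<close> \<open>W\<close> into \<open>G\<close> by some \<theta>. The map sending
  \<open>a\<close> to \<open>(\<theta> (proj a), parity a)\<close> then embeds \<open>W\<close> into
  the direct product, its kernel being a torsion part of the joint kernel.\<close>

lemma Higman_subgroup_property_C2_power:
  assumes "group G" "finite (carrier G)" and Higman: "Higman_subgroup_property G"
  shows "Higman_subgroup_property (G \<times>\<times> C2_power m)"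
proof -
  let ?K = "G \<times>\<times> C2_power m"
  let ?one = "\<one>\<^bsub>cocycles2 G\<^esub>" and ?ONE = "\<one>\<^bsub>cocycles2 ?K\<^esub>"
  interpret G: group G by fact
  have K: "group ?K" "finite (carrier ?K)"
    using assms C2_power_group C2_power_finite by (auto intro: DirProd_group)
  have "?ONE (x, y) = ?one (fst x, fst y)" if "x \<in> carrier ?K" "y \<in> carrier ?K" for x y
  proof -
    have "fst x \<in> carrier G" "fst y \<in> carrier G" using that by auto
    then show ?thesis using that by (simp only: trivial_cocycle_apply)
  qed
  \<comment> \<open>The trivial cocycle of the product is the inflation of the trivial cocycle of
    \<open>G\<close>, so the constant cochain 1 suffices.\<close>
  then interpret inflated_twisted_rings G m ?one ?ONE "\<lambda>_. 1"
    unfolding inflated_twisted_rings_def inflated_twisted_rings_axioms_def twisted_ring_def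
      twisted_ring_axioms_def
    using assms(1,2) K trivial_cocycle[OF assms(1)] trivial_cocycle[OF K(1)]
    by (simp del: one_DirProd carrier_DirProd)
  \<comment> \<open>Since the cochain is constantly 1, \<open>proj\<close> introduces no signs; it
    therefore maps normalized units to normalized units.\<close>
  have aug_proj: "augmentation (proj f) = augmentation f" for f
    using subset_UNIV
    by (induction f rule: frag_induction)
       (simp_all add: proj_def frag_extend_diff augmentation_eq_frag_sum frag_sum_diff)
  show ?thesis
    unfolding Higman_subgroup_property_def
  proof (intro allI impI, elim conjE)
    fix W assume W: "subgroup W (normalized_units ?K)" and "finite W"
    have groups: "group (normalized_units ?K)" "group (normalized_units G)"
      using normalized_units_group assms(1,2) K by blast+
    have "W \<subseteq> carrier (normalized_units ?K)" using W by (rule subgroup.subset)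
    then have W_units: "W \<subseteq> carrier (twisted_units ?K ?ONE)" by (auto simp: normalized_units_eq)
    interpret W: group "(normalized_units ?K)\<lparr>carrier := W\<rparr>"
      using group.subgroup_imp_group[OF groups(1) W] .
    have proj_norm: "proj \<in> hom (normalized_units ?K) (normalized_units G)"
      using proj_hom by (auto simp: hom_def normalized_units_eq aug_proj)
    interpret proj: group_hom "normalized_units ?K" "normalized_units G" proj
      using groups proj_norm by (simp add: group_hom_def group_hom_axioms_def)
    have "subgroup (proj ` W) (normalized_units G)"
      using proj.subgroup_img_is_subgroup[OF W] .
    then obtain L \<theta> where L: "subgroup L G"
      and \<theta>: "\<theta> \<in> iso ((normalized_units G)\<lparr>carrier := proj ` W\<rparr>) (G\<lparr>carrier := L\<rparr>)"
      using Higman \<open>finite W\<close> unfolding Higman_subgroup_property_def is_iso_def by blast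
    interpret V: group "(normalized_units G)\<lparr>carrier := proj ` W\<rparr>"
      using group.subgroup_imp_group[OF groups(2) \<open>subgroup (proj ` W) _\<close>] .
    interpret L: group "G\<lparr>carrier := L\<rparr>"
      using G.subgroup_imp_group[OF L] .
    have \<theta>_hom: "\<theta> \<in> hom ((normalized_units G)\<lparr>carrier := proj ` W\<rparr>) (G\<lparr>carrier := L\<rparr>)"
      and \<theta>_inj: "inj_on \<theta> (proj ` W)"
      using \<theta> by (auto simp: iso_def bij_betw_def)
    interpret \<theta>: group_hom "(normalized_units G)\<lparr>carrier := proj ` W\<rparr>" "G\<lparr>carrier := L\<rparr>" \<theta>
      using \<theta>_hom by unfold_locales
    have "(\<lambda>a. (\<theta> (proj a), parity a)) \<in> hom ((normalized_units ?K)\<lparr>carrier := W\<rparr>) ?K"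
    proof (rule homI)
      fix a assume "a \<in> carrier ((normalized_units ?K)\<lparr>carrier := W\<rparr>)"
      then have "a \<in> W" by simp
      then have "\<theta> (proj a) \<in> L" using \<theta>.hom_closed[of "proj a"] by simp
      then show "(\<theta> (proj a), parity a) \<in> carrier ?K"
        using parity_closed subgroup.subset[OF L] by auto
    next
      fix a b assume "a \<in> carrier ((normalized_units ?K)\<lparr>carrier := W\<rparr>)"
        "b \<in> carrier ((normalized_units ?K)\<lparr>carrier := W\<rparr>)"
      then have ab: "a \<in> W" "b \<in> W" by simp_all
      have "proj (a \<otimes>\<^bsub>normalized_units ?K\<^esub> b) = proj a \<otimes>\<^bsub>normalized_units G\<^esub> proj b"
        using ab subgroup.subset[OF W] by (intro proj.hom_mult) auto
      moreover have "\<theta> (proj a \<otimes>\<^bsub>normalized_units G\<^esub> proj b) = \<theta> (proj a) \<otimes>\<^bsub>G\<^esub> \<theta> (proj b)"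
        using \<theta>.hom_mult[of "proj a" "proj b"] ab by simp
      moreover have "parity (a \<otimes>\<^bsub>normalized_units ?K\<^esub> b) = parity a \<otimes>\<^bsub>E\<^esub> parity b"
        using hom_mult[OF parity_hom, of a b] ab W_units by (auto simp: normalized_units_eq)
      ultimately show "(\<theta> (proj (a \<otimes>\<^bsub>(normalized_units ?K)\<lparr>carrier := W\<rparr>\<^esub> b)),
          parity (a \<otimes>\<^bsub>(normalized_units ?K)\<lparr>carrier := W\<rparr>\<^esub> b))
        = (\<theta> (proj a), parity a) \<otimes>\<^bsub>?K\<^esub> (\<theta> (proj b), parity b)"
        by simp
    qed
    moreover have "a = \<one>\<^bsub>(normalized_units ?K)\<lparr>carrier := W\<rparr>\<^esub>"
      if "a \<in> carrier ((normalized_units ?K)\<lparr>carrier := W\<rparr>)"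
        and "(\<theta> (proj a), parity a) = \<one>\<^bsub>?K\<^esub>" for a
    proof -
      have a: "a \<in> W" "\<theta> (proj a) = \<one>\<^bsub>G\<^esub>" "parity a = \<one>\<^bsub>E\<^esub>" using that by simp_all
      have "\<theta> (proj a) = \<theta> \<one>\<^bsub>normalized_units G\<^esub>" using a \<theta>.hom_one by simp
      then have "proj a = \<one>\<^bsub>normalized_units G\<^esub>"
        using \<theta>_inj a V.one_closed by (auto dest: inj_onD)
      then have "proj a = frag_of \<one>\<^bsub>G\<^esub>" by (simp add: normalized_units_eq base.U_one)
      \<comment> \<open>Finiteness of \<open>W\<close> enters here: the power with exponent
        \<open>card W\<close> is the identity, so \<open>torsion_kernel_trivial\<close>
        applies.\<close>
      moreover have "a [^]\<^bsub>(normalized_units ?K)\<lparr>carrier := W\<rparr>\<^esub> card W = \<one>\<^bsub>(normalized_units ?K)\<lparr>carrier := W\<rparr>\<^esub>"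
        using W.pow_order_eq_1[of a] a by (simp add: Coset.order_def)
      then have "a [^]\<^bsub>top.R\<^esub> card W = frag_of \<one>\<^bsub>?K\<^esub>"
        by (simp add: normalized_units_eq top.U_pow top.U_one)
      moreover have "0 < card W" using a \<open>finite W\<close> by (auto simp: card_gt_0_iff)
      ultimately have "a = frag_of \<one>\<^bsub>?K\<^esub>"
        using torsion_kernel_trivial a W_units by (auto simp only: top.U_carrier)
      then show ?thesis by (simp add: normalized_units_eq top.U_one)
    qed
    ultimately show "\<exists>L. subgroup L ?K \<and> (normalized_units ?K)\<lparr>carrier := W\<rparr> \<cong> ?K\<lparr>carrier := L\<rparr>"
      using injective_hom_iso_subgroup[OF W.is_group K(1)] by blast
  qed
qed

text \<open>\<gamma> lies in its own class by way of the coboundary of the constant 1. Equality of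
  the classes then writes it as a coboundary times \<beta>.\<close>

lemma cohomologous_obtain:
  assumes "group H" and \<gamma>: "\<gamma> \<in> carrier (cocycles2 H)"
    and eq: "cohomology_class H \<gamma> = cohomology_class H \<beta>"
  obtains c where "\<And>x. x \<in> carrier H \<Longrightarrow> c x \<in> {1, -1}" "c \<one>\<^bsub>H\<^esub> = 1"
    "\<And>x y. x \<in> carrier H \<Longrightarrow> y \<in> carrier H \<Longrightarrow>
      \<gamma> (x, y) = c x * c y * c (x \<otimes>\<^bsub>H\<^esub> y) * \<beta> (x, y)"
proof -
  interpret group H by fact
  have "\<gamma> \<in> carrier H \<times> carrier H \<rightarrow>\<^sub>E {1, -1}" using \<gamma> by (simp add: cocycles2_def)
  \<comment> \<open>Multiplication in \<open>cocycles2 H\<close> restricts its result, so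
    multiplying by the trivial coboundary returns \<gamma> only because \<gamma> is
    extensional.\<close>
  then have "restrict \<gamma> (carrier H \<times> carrier H) = \<gamma>" by (rule PiE_restrict)
  moreover have "coboundary2 H (\<lambda>x\<in>carrier H. 1) \<otimes>\<^bsub>cocycles2 H\<^esub> \<gamma> = restrict \<gamma> (carrier H \<times> carrier H)"
    by (simp add: cocycles2_def) (rule restrict_ext, auto simp: coboundary2_def)
  ultimately have "coboundary2 H (\<lambda>x\<in>carrier H. 1) \<otimes>\<^bsub>cocycles2 H\<^esub> \<gamma> = \<gamma>"
    by simp
  moreover have "coboundary2 H (\<lambda>x\<in>carrier H. 1) \<in> coboundaries2 H"
    by (auto simp: coboundaries2_def)
  then have "coboundary2 H (\<lambda>x\<in>carrier H. 1) \<otimes>\<^bsub>cocycles2 H\<^esub> \<gamma> \<in> cohomology_class H \<gamma>"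
    unfolding cohomology_class_def r_coset_def by blast
  ultimately have "\<gamma> \<in> cohomology_class H \<beta>" using eq by simp
  then have "\<exists>h\<in>coboundaries2 H. \<gamma> = h \<otimes>\<^bsub>cocycles2 H\<^esub> \<beta>"
    unfolding cohomology_class_def r_coset_def by blast
  then obtain c where c: "c \<in> carrier H \<rightarrow>\<^sub>E {1, -1}" "c \<one>\<^bsub>H\<^esub> = 1"
    and \<gamma>_eq: "\<gamma> = coboundary2 H c \<otimes>\<^bsub>cocycles2 H\<^esub> \<beta>"
    unfolding coboundaries2_def by blast
  show ?thesis
  proof (rule that)
    show "c x \<in> {1, -1}" if "x \<in> carrier H" for x using c(1) that by (rule PiE_mem)
    show "\<gamma> (x, y) = c x * c y * c (x \<otimes>\<^bsub>H\<^esub> y) * \<beta> (x, y)"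
      if "x \<in> carrier H" "y \<in> carrier H" for x y
      using that by (simp add: \<gamma>_eq cocycles2_def coboundary2_def)
  qed (rule c(2))
qed

theorem theorem6:
  fixes G :: "('a, 'b) monoid_scheme" and m :: nat
    and \<delta> :: "'a \<times> 'a \<Rightarrow> int"
    and \<gamma> :: "('a \<times> (nat \<Rightarrow> int)) \<times> ('a \<times> (nat \<Rightarrow> int)) \<Rightarrow> int"
  assumes "group G" and "finite (carrier G)"
    and "\<delta> \<in> carrier (cocycles2 G)"
    and "\<gamma> \<in> carrier (cocycles2 (G \<times>\<times> C2_power m))"
    and "cohomology_class (G \<times>\<times> C2_power m) \<gamma> =
         cohomology_class (G \<times>\<times> C2_power m) (inflation (G \<times>\<times> C2_power m) fst \<delta>)"
  shows "(has_normal_complement G \<delta> \<longrightarrow> has_normal_complement (G \<times>\<times> C2_power m) \<gamma>) \<and>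
         (has_torsion_free_normal_complement G \<delta> \<longrightarrow>
            has_torsion_free_normal_complement (G \<times>\<times> C2_power m) \<gamma>) \<and>
         (Higman_subgroup_property G \<longrightarrow> Higman_subgroup_property (G \<times>\<times> C2_power m))"
proof -
  let ?K = "G \<times>\<times> C2_power m"
  have K: "group ?K" "finite (carrier ?K)"
    using assms C2_power_group C2_power_finite by (auto intro: DirProd_group)
  obtain c where c: "\<And>x. x \<in> carrier ?K \<Longrightarrow> c x \<in> {1, -1}" "c \<one>\<^bsub>?K\<^esub> = 1"
    "\<And>x y. x \<in> carrier ?K \<Longrightarrow> y \<in> carrier ?K \<Longrightarrow>
      \<gamma> (x, y) = c x * c y * c (x \<otimes>\<^bsub>?K\<^esub> y) * inflation ?K fst \<delta> (x, y)"
    using cohomologous_obtain[OF K(1) assms(4,5)] by metis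
  have "inflated_twisted_rings G m \<delta> \<gamma> c"
    unfolding inflated_twisted_rings_def inflated_twisted_rings_axioms_def twisted_ring_def
      twisted_ring_axioms_def
    using assms K c by (simp add: inflation_def del: one_DirProd carrier_DirProd)
  then show ?thesis
    using inflated_twisted_rings.has_normal_complement_inflated
      inflated_twisted_rings.has_torsion_free_normal_complement_inflated
      Higman_subgroup_property_C2_power[OF assms(1,2)] by blast
qed

end
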